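(* (Sylvester's theorem for the quantum Berezinian.) Let $k\ge0$, let $M$ be the generator matrix of $\widetilde{\mathcal{M}}_{m|n}$, and denote the generator matrix of $\mathcal{M}_{k+m|n}$ by $M_{k+m|n}$. Then $$\psi_k(\mathrm{Ber}_q(M))={\det}_q\big(M^{1,\dots,k}_{1,\dots,k}\big)^{-1}\,\mathrm{Ber}_q(M_{k+m|n}),$$ where $M^{1,\dots,k}_{1,\dots,k}$ is the upper left $k\times k$ submatrix of $M_{k+m|n}$.
   Context: Let $q$ be a nonzero parameter, $m,n\ge0$ integers, $[k]=\{1,\dots,k\}$. For type $m|n$, an index $i\in[m+n]$ has parity $\bar i=0$ if $i\le m$ and $\bar i=1$ if $i>m$. Put $\varepsilon(a)=1,0,-1$ according to $a>0,a=0,a<0$. $l(\sigma)$ is the number of inversions of a permutation. A matrix $A=(A_{ij})_{i,j\in[m+n]}$ over a superalgebra, $A_{ij}$ of parity $\bar i+\bar j$, satisfies the relations $R^q$ (is a $q$-super Manin matrix of type $m|n$) if: (1) $A_{ij}^2=0$ if $\bar i=1,\bar j=0$; (2) $A_{ik}A_{il}=q^{\varepsilon(l-k)}(-1)^{(\bar k+1)(\bar l+1)}A_{il}A_{ik}$ if $\bar i=1$; (3) $A_{ik}A_{jk}=q^{\varepsilon(i-j)}(-1)^{\bar i\bar j}A_{jk}A_{ik}$ if $\bar k=0$; (4) for all $i,j,k,l$: $A_{ij}A_{kl}-q^{\varepsilon(i-k)+\varepsilon(l-j)}(-1)^{(\bar i+\bar j)(\bar k+\bar l)}A_{kl}A_{ij}=q^{\varepsilon(i-k)}(-1)^{\bar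 i\bar k+\bar j\bar k+\bar i\bar j}A_{kj}A_{il}-q^{\varepsilon(l-j)}(-1)^{\bar j\bar k+\bar j\bar l+\bar k\bar l}A_{il}A_{kj}$. $\mathcal{M}_{m|n}$ is the superalgebra generated by the entries of a matrix $M$ subject to $R^q$. The supertranspose is $(A^{st})_{ij}=(-1)^{\bar i(\bar i+\bar j)}A_{ji}$. $\widetilde{\mathcal{M}}_{m|n}$ is the unital associative superalgebra generated by the entries of two matrices $M$ and $M^{-1}$ ($(i,j)$ entries of parity $\bar i+\bar j$) subject to: $M$ satisfies $R^q$; $M^{-1}$ satisfies $R^{q^{-1}}$ (i.e. $R^q$ with $q$ replaced by $q^{-1}$); $MM^{-1}=M^{-1}M=1$; and $M^{st}(M^{-1})^{st}=(M^{-1})^{st}M^{st}=1$. For an invertible matrix $A$ of type $r|s$ (first $r$ indices even, last $s$ odd) the quantum Berezinian is $$\mathrm{Ber}_q(A)=\sum_{\sigma\in\mathfrak{S}_r}(-q)^{-l(\sigma)}A_{\sigma(1),1}\cdots A_{\sigma(r),r}\times\sum_{\rho\in\mathfrak{S}_s}(-q)^{-l(\rho)}(A^{-1})_{r+1,r+\rho(1)}\cdots(A^{-1})_{r+s,r+\rho(s)},$$ and for a matrix $A$ with even indices only (type $k|0$), $\det_q(A)=\mathrm{Ber}_q(A)=\sum_{\sigma\in\mathfrak{S}_k}(-q)^{-l(\sigma)}A_{\sigma(1),1}\cdots A_{\sigma(k),k}$. Maps: $\phi_k:\mathcal{M}_{m|n}\to\mathcal{M}_{k+m|n}$ is the homomorphism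 $M_{ij}\mapsto M_{k+i,k+j}$ (extended to $\widetilde{\mathcal{M}}_{m|n}$ by sending $M^{-1}$ to the inverse of the lower right $(m+n)\times(m+n)$ submatrix); $\omega_{m|n}$ is the (super) anti-isomorphism of $\widetilde{\mathcal{M}}_{m|n}$ with $\omega_{m|n}(M)=M^{-1}$, where anti means $\omega(uv)=(-1)^{\bar u\bar v}\omega(v)\omega(u)$; and $\psi_k=\omega_{k+m|n}\circ\phi_k\circ\omega_{m|n}$. Standing conventions: all inverses of submatrices, quasideterminants and determinants that are needed are assumed to exist (in a suitable extension of $\widetilde{\mathcal{M}}_{k+m|n}$), and a principal submatrix of type $r|s$ of the generator matrix together with its inverse is regarded as the generator matrix of $\widetilde{\mathcal{M}}_{r|s}$ together with its antipode image (i.e. they satisfy the defining relations of $\widetilde{\mathcal{M}}_{r|s}$); likewise for principal submatrices of the inverse of the generator matrix with $q$ replaced by $q^{-1}$. *)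

theory Defs
  imports
    Complex_Main
    "HOL-Library.Z2"
    "HOL-Library.Poly_Mapping"
    "HOL-Combinatorics.Permutations"
begin

section \<open>Superalgebras\<close>

text \<open>
  Parities live in the two-element field \<^typ>\<open>bit\<close>, so that sign exponents can be written
  literally.  A superalgebra structure on a ring with unit is given by a scalar
  multiplication and the two homogeneous parts.
\<close>

definition sg :: "bit \<Rightarrow> 'k::field" where
  "sg e = (if e = 0 then 1 else - 1)"

locale superalgebra = vector_space scale
  for scale :: "'k::field \<Rightarrow> 'a::ring_1 \<Rightarrow> 'a" +
  fixes part :: "bit \<Rightarrow> 'a set"
  assumes scale_mult_left: "scale c x * y = scale c (x * y)"
    and scale_mult_right: "x * scale c y = scale c (x * y)"
    and part_subspace: "subspace (part e)"
    and part_sum: "\<exists>y\<in>part 0. \<exists>z\<in>part 1. x = y + z"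
    and part_disjoint: "part 0 \<inter> part 1 = {0}"
    and part_one: "1 \<in> part 0"
    and part_mult: "x \<in> part e \<Longrightarrow> y \<in> part f \<Longrightarrow> x * y \<in> part (e + f)"

definition superalg_hom ::
  "('k::field \<Rightarrow> 'a::ring_1 \<Rightarrow> 'a) \<Rightarrow> (bit \<Rightarrow> 'a set) \<Rightarrow>
   ('k \<Rightarrow> 'b::ring_1 \<Rightarrow> 'b) \<Rightarrow> (bit \<Rightarrow> 'b set) \<Rightarrow> ('a \<Rightarrow> 'b) \<Rightarrow> bool" where
  "superalg_hom sA pA sB pB f \<longleftrightarrow>
     Vector_Spaces.linear sA sB f \<and> f 1 = 1 \<and>
     (\<forall>e. f ` pA e \<subseteq> pB e) \<and> (\<forall>x y. f (x * y) = f x * f y)"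

definition superalg_anti_hom ::
  "('k::field \<Rightarrow> 'a::ring_1 \<Rightarrow> 'a) \<Rightarrow> (bit \<Rightarrow> 'a set) \<Rightarrow>
   ('k \<Rightarrow> 'b::ring_1 \<Rightarrow> 'b) \<Rightarrow> (bit \<Rightarrow> 'b set) \<Rightarrow> ('a \<Rightarrow> 'b) \<Rightarrow> bool" where
  "superalg_anti_hom sA pA sB pB f \<longleftrightarrow>
     Vector_Spaces.linear sA sB f \<and> f 1 = 1 \<and>
     (\<forall>e. f ` pA e \<subseteq> pB e) \<and>
     (\<forall>e d. \<forall>x\<in>pA e. \<forall>y\<in>pA d. f (x * y) = sB (sg (e * d)) (f y * f x))"

section \<open>Free algebras and presentations\<close>

datatype 'g word = Word (letters: "'g list")

instantiation word :: (type) monoid_add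
begin
definition zero_word :: "'a word" where "0 = Word []"
definition plus_word :: "'a word \<Rightarrow> 'a word \<Rightarrow> 'a word" where
  "u + v = Word (letters u @ letters v)"
instance by standard (simp_all add: zero_word_def plus_word_def)
end

text \<open>
  The multiplication of \<^typ>\<open>'g word \<Rightarrow>\<^sub>0 'k\<close> is the convolution over concatenation of
  words, so this type is the free unital associative algebra on \<^typ>\<open>'g\<close>.
\<close>

type_synonym ('g, 'k) free_alg = "'g word \<Rightarrow>\<^sub>0 'k"

definition free_gen :: "'g \<Rightarrow> ('g, 'k::field) free_alg" where
  "free_gen g = Poly_Mapping.single (Word [g]) 1"

definition free_scale :: "'k::field \<Rightarrow> ('g, 'k) free_alg \<Rightarrow> ('g, 'k) free_alg" where
  "free_scale c p = Poly_Mapping.single 0 c * p"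

definition free_on :: "'g set \<Rightarrow> ('g, 'k::field) free_alg set" where
  "free_on G = {p. \<forall>w\<in>Poly_Mapping.keys p. set (letters w) \<subseteq> G}"

definition free_eval ::
  "('k::field \<Rightarrow> 'a::ring_1 \<Rightarrow> 'a) \<Rightarrow> ('g \<Rightarrow> 'a) \<Rightarrow> ('g, 'k) free_alg \<Rightarrow> 'a" where
  "free_eval scale x p =
     (\<Sum>w\<in>Poly_Mapping.keys p. scale (Poly_Mapping.lookup p w) (prod_list (map x (letters w))))"

text \<open>A relation is a pair of sides; the ideal below is two-sided.\<close>

inductive_set rel_ideal ::
  "'g set \<Rightarrow> (('g, 'k::field) free_alg \<times> ('g, 'k) free_alg) set \<Rightarrow> ('g, 'k) free_alg set"
  for G R where
  zero: "0 \<in> rel_ideal G R"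
| step: "p \<in> rel_ideal G R \<Longrightarrow> (a, b) \<in> R \<Longrightarrow> u \<in> free_on G \<Longrightarrow> v \<in> free_on G \<Longrightarrow>
         p + u * (a - b) * v \<in> rel_ideal G R"

text \<open>
  The algebra is generated by the elements \<open>x g\<close> with \<open>g \<in> G\<close>, subject to the relations \<open>R\<close>:
  evaluation identifies it with the quotient of the free algebra on \<open>G\<close> by the ideal of \<open>R\<close>.
\<close>

definition presented_by ::
  "('k::field \<Rightarrow> 'a::ring_1 \<Rightarrow> 'a) \<Rightarrow> 'g set \<Rightarrow> ('g \<Rightarrow> 'a) \<Rightarrow>
   (('g, 'k) free_alg \<times> ('g, 'k) free_alg) set \<Rightarrow> bool" where
  "presented_by scale G x R \<longleftrightarrow>
     free_eval scale x ` free_on G = UNIV \<and>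
     (\<forall>p\<in>free_on G. free_eval scale x p = 0 \<longleftrightarrow> p \<in> rel_ideal G R)"

section \<open>The relations\<close>

text \<open>
  A matrix is a function of two indices, of which only the values at indices from 1 up to its
  size matter.  The sign of an integer, \<^const>\<open>sgn\<close>, plays the role of epsilon.
\<close>

definition par :: "nat \<Rightarrow> nat \<Rightarrow> bit" where
  "par m i = (if i \<le> m then 0 else 1)"

definition eps :: "nat \<Rightarrow> nat \<Rightarrow> int" where
  "eps i j = sgn (int i - int j)"

definition manin_rels ::
  "('k::field \<Rightarrow> 'a::ring_1 \<Rightarrow> 'a) \<Rightarrow> 'k \<Rightarrow> nat \<Rightarrow> nat \<Rightarrow> (nat \<Rightarrow> nat \<Rightarrow> 'a) \<Rightarrow> ('a \<times> 'a) set" where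
  "manin_rels scale q m n A =
     (let I = {1..m+n}; P = par m in
       {(A i j * A i j, 0) | i j. i \<in> I \<and> j \<in> I \<and> P i = 1 \<and> P j = 0}
     \<union> {(A i k * A i l,
          scale (q powi eps l k * sg ((P k + 1) * (P l + 1))) (A i l * A i k)) | i k l.
          i \<in> I \<and> k \<in> I \<and> l \<in> I \<and> P i = 1}
     \<union> {(A i k * A j k,
          scale (q powi eps i j * sg (P i * P j)) (A j k * A i k)) | i j k.
          i \<in> I \<and> j \<in> I \<and> k \<in> I \<and> P k = 0}
     \<union> {(A i j * A k l
            - scale (q powi (eps i k + eps l j) * sg ((P i + P j) * (P k + P l))) (A k l * A i j),
          scale (q powi eps i k * sg (P i * P k + P j * P k + P i * P j)) (A k j * A i l)
            - scale (q powi eps l j * sg (P j * P k + P j * P l + P k * P l)) (A i l * A k j))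
          | i j k l. i \<in> I \<and> j \<in> I \<and> k \<in> I \<and> l \<in> I})"

definition supertranspose ::
  "('k::field \<Rightarrow> 'a::ring_1 \<Rightarrow> 'a) \<Rightarrow> nat \<Rightarrow> (nat \<Rightarrow> nat \<Rightarrow> 'a) \<Rightarrow> nat \<Rightarrow> nat \<Rightarrow> 'a" where
  "supertranspose scale m A i j = scale (sg (par m i * (par m i + par m j))) (A j i)"

definition inverse_rels ::
  "nat \<Rightarrow> (nat \<Rightarrow> nat \<Rightarrow> 'a::ring_1) \<Rightarrow> (nat \<Rightarrow> nat \<Rightarrow> 'a) \<Rightarrow> ('a \<times> 'a) set" where
  "inverse_rels N A B =
     {((\<Sum>l=1..N. A i l * B l j), if i = j then 1 else 0) | i j. i \<in> {1..N} \<and> j \<in> {1..N}}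
   \<union> {((\<Sum>l=1..N. B i l * A l j), if i = j then 1 else 0) | i j. i \<in> {1..N} \<and> j \<in> {1..N}}"

text \<open>The defining relations of the algebra generated by a matrix \<open>A\<close> and its inverse \<open>B\<close>.\<close>

definition tilde_rels ::
  "('k::field \<Rightarrow> 'a::ring_1 \<Rightarrow> 'a) \<Rightarrow> 'k \<Rightarrow> nat \<Rightarrow> nat \<Rightarrow>
   (nat \<Rightarrow> nat \<Rightarrow> 'a) \<Rightarrow> (nat \<Rightarrow> nat \<Rightarrow> 'a) \<Rightarrow> ('a \<times> 'a) set" where
  "tilde_rels scale q m n A B =
     manin_rels scale q m n A \<union> manin_rels scale (inverse q) m n B
   \<union> inverse_rels (m + n) A B
   \<union> inverse_rels (m + n) (supertranspose scale m A) (supertranspose scale m B)"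

definition parity_matrix ::
  "(bit \<Rightarrow> 'a set) \<Rightarrow> nat \<Rightarrow> nat \<Rightarrow> (nat \<Rightarrow> nat \<Rightarrow> 'a) \<Rightarrow> bool" where
  "parity_matrix part m n A \<longleftrightarrow>
     (\<forall>i\<in>{1..m+n}. \<forall>j\<in>{1..m+n}. A i j \<in> part (par m i + par m j))"

definition tilde_pair ::
  "('k::field \<Rightarrow> 'a::ring_1 \<Rightarrow> 'a) \<Rightarrow> (bit \<Rightarrow> 'a set) \<Rightarrow> 'k \<Rightarrow> nat \<Rightarrow> nat \<Rightarrow>
   (nat \<Rightarrow> nat \<Rightarrow> 'a) \<Rightarrow> (nat \<Rightarrow> nat \<Rightarrow> 'a) \<Rightarrow> bool" where
  "tilde_pair scale part q m n A B \<longleftrightarrow>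
     parity_matrix part m n A \<and> parity_matrix part m n B \<and>
     (\<forall>(a, b) \<in> tilde_rels scale q m n A B. a = b)"

section \<open>The superalgebra of a generic matrix and its inverse\<close>

datatype gen = Ent nat nat | InvEnt nat nat

definition gens :: "nat \<Rightarrow> gen set" where
  "gens N = {Ent i j | i j. i \<in> {1..N} \<and> j \<in> {1..N}}
          \<union> {InvEnt i j | i j. i \<in> {1..N} \<and> j \<in> {1..N}}"

text \<open>
  The superalgebra is characterized, up to isomorphism, by its presentation.  All relations
  are homogeneous, so the parities of the generators determine the grading.
\<close>

definition is_Mtilde ::
  "'k::field \<Rightarrow> nat \<Rightarrow> nat \<Rightarrow> ('k \<Rightarrow> 'a::ring_1 \<Rightarrow> 'a) \<Rightarrow> (bit \<Rightarrow> 'a set) \<Rightarrow>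
   (nat \<Rightarrow> nat \<Rightarrow> 'a) \<Rightarrow> (nat \<Rightarrow> nat \<Rightarrow> 'a) \<Rightarrow> bool" where
  "is_Mtilde q m n scale part M Minv \<longleftrightarrow>
     superalgebra scale part \<and>
     parity_matrix part m n M \<and> parity_matrix part m n Minv \<and>
     presented_by scale (gens (m + n)) (case_gen M Minv)
       (tilde_rels free_scale q m n
         (\<lambda>i j. free_gen (Ent i j)) (\<lambda>i j. free_gen (InvEnt i j)))"

definition is_omega ::
  "nat \<Rightarrow> nat \<Rightarrow> ('k::field \<Rightarrow> 'a::ring_1 \<Rightarrow> 'a) \<Rightarrow> (bit \<Rightarrow> 'a set) \<Rightarrow>
   (nat \<Rightarrow> nat \<Rightarrow> 'a) \<Rightarrow> (nat \<Rightarrow> nat \<Rightarrow> 'a) \<Rightarrow> ('a \<Rightarrow> 'a) \<Rightarrow> bool" where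
  "is_omega m n scale part M Minv \<omega> \<longleftrightarrow>
     superalg_anti_hom scale part scale part \<omega> \<and> bij \<omega> \<and>
     (\<forall>i\<in>{1..m+n}. \<forall>j\<in>{1..m+n}. \<omega> (M i j) = Minv i j)"

section \<open>Quantum determinant and Berezinian\<close>

definition inversions :: "nat \<Rightarrow> (nat \<Rightarrow> nat) \<Rightarrow> nat" where
  "inversions r \<sigma> = card {(i, j). 1 \<le> i \<and> i < j \<and> j \<le> r \<and> \<sigma> j < \<sigma> i}"

definition qdet ::
  "('k::field \<Rightarrow> 'a::ring_1 \<Rightarrow> 'a) \<Rightarrow> 'k \<Rightarrow> nat \<Rightarrow> (nat \<Rightarrow> nat \<Rightarrow> 'a) \<Rightarrow> 'a" where
  "qdet scale q r A =
     (\<Sum>\<sigma> | \<sigma> permutes {1..r}.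
        scale ((- q) powi (- int (inversions r \<sigma>)))
          (prod_list (map (\<lambda>j. A (\<sigma> j) j) [1..<Suc r])))"

text \<open>The last argument is the inverse of the matrix.\<close>

definition qBer ::
  "('k::field \<Rightarrow> 'a::ring_1 \<Rightarrow> 'a) \<Rightarrow> 'k \<Rightarrow> nat \<Rightarrow> nat \<Rightarrow>
   (nat \<Rightarrow> nat \<Rightarrow> 'a) \<Rightarrow> (nat \<Rightarrow> nat \<Rightarrow> 'a) \<Rightarrow> 'a" where
  "qBer scale q r s A Ainv =
     qdet scale q r A *
     (\<Sum>\<rho> | \<rho> permutes {1..s}.
        scale ((- q) powi (- int (inversions s \<rho>)))
          (prod_list (map (\<lambda>i. Ainv (r + i) (r + \<rho> i)) [1..<Suc s])))"

end

theory Submission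
  imports Defs "HOL-Combinatorics.Multiset_Permutations"
begin

text \<open>
  On generators, \<open>\<omega>\<close> exchanges a matrix and its inverse.  Hence \<open>\<psi>\<^sub>k\<close> sends the second factor of
  the Berezinian to the second factor of the larger Berezinian, and the first one to the
  quantum determinant of the even part of \<open>P\<close>, the inverse of the lower right block of the inverse
  matrix, i.e. a Schur complement.  What remains concerns even indices only:
  \<open>det A = det A\<^sub>1\<^sub>1 * det P\<close>.  Column \<open>j\<close> of a Manin matrix gives \<open>f\<^sub>j = \<Sum>i. A\<^sub>i\<^sub>j e\<^sub>i\<close> in the quantum
  exterior algebra; the Manin relations say that the \<open>f\<^sub>j\<close> square to zero and q-anticommute, and the
  determinant is the coefficient of their product.  Right multiples of the first \<open>k\<close> columns may
  therefore be added to the later ones, which turns these into the columns of \<open>P\<close> below a zero block.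
\<close>

section \<open>Evaluation of free algebra elements\<close>

lemma free_on_one [simp]: "1 \<in> free_on G"
  by (auto simp: free_on_def one_poly_mapping.abs_eq[symmetric] zero_word_def
      simp flip: single_one split: if_splits)

lemma free_on_diff: "a \<in> free_on G \<Longrightarrow> b \<in> free_on G \<Longrightarrow> a - b \<in> free_on G"
  using keys_diff[of a b] unfolding free_on_def by auto

lemma free_on_add: "a \<in> free_on G \<Longrightarrow> b \<in> free_on G \<Longrightarrow> a + b \<in> free_on G"
  using keys_add[of a b] unfolding free_on_def by auto

lemma free_on_mult: "a \<in> free_on G \<Longrightarrow> b \<in> free_on G \<Longrightarrow> a * b \<in> free_on G"
  using keys_mult[of a b] unfolding free_on_def by (fastforce simp: plus_word_def)

lemma free_on_scale: "a \<in> free_on G \<Longrightarrow> free_scale c a \<in> free_on G"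
  unfolding free_scale_def
  by (rule free_on_mult) (auto simp: free_on_def zero_word_def)

lemma free_on_zero [simp]: "0 \<in> free_on G"
  by (simp add: free_on_def)

lemma free_on_sum: "(\<And>i. i \<in> S \<Longrightarrow> f i \<in> free_on G) \<Longrightarrow> sum f S \<in> free_on G"
  by (induction S rule: infinite_finite_induct) (auto intro: free_on_add)

lemma free_on_gen: "g \<in> G \<Longrightarrow> free_gen g \<in> free_on G"
  by (auto simp: free_on_def free_gen_def)

text \<open>Setting a coefficient outside the support adds a monomial, so additive properties need
  only be checked on monomials. This reduces multiplicativity of \<open>free_eval\<close> to
  concatenation of words.\<close>

lemma poly_mapping_single_add_induct [case_names zero single add]:
  assumes "P 0" "\<And>w c. P (Poly_Mapping.single w c)" "\<And>a b. P a \<Longrightarrow> P b \<Longrightarrow> P (a + b)"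
  shows "P (p :: 'w \<Rightarrow>\<^sub>0 'c::comm_monoid_add)"
proof (induction p rule: update_induct)
  case (update p w c)
  then have "Poly_Mapping.update w c p = Poly_Mapping.single w c + p"
    by (intro poly_mapping_eqI)
      (auto simp: lookup_add lookup_update lookup_single in_keys_iff when_def)
  then show ?case
    using assms update by simp
qed (rule assms)

context superalgebra
begin

text \<open>Words outside the support have coefficient zero. Enlarging the index set lets two
  elements be summed over a common set.\<close>

lemma free_eval_superset:
  assumes "finite S" "Poly_Mapping.keys p \<subseteq> S"
  shows "free_eval scale x p =
    (\<Sum>w\<in>S. scale (Poly_Mapping.lookup p w) (prod_list (map x (letters w))))"
  unfolding free_eval_def
  by (rule sum.mono_neutral_left) (use assms in \<open>auto simp: in_keys_iff\<close>)

lemma free_eval_add: "free_eval scale x (a + b) = free_eval scale x a + free_eval scale x b"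
proof -
  let ?S = "Poly_Mapping.keys a \<union> Poly_Mapping.keys b"
  have "Poly_Mapping.keys (a + b) \<subseteq> ?S"
    by (rule keys_add)
  then show ?thesis
    by (simp add: free_eval_superset[where S = ?S] lookup_add scale_left_distrib sum.distrib)
qed

lemma free_eval_single:
  "free_eval scale x (Poly_Mapping.single w c) = scale c (prod_list (map x (letters w)))"
  by (simp add: free_eval_superset[where S = "{w}"])

lemma free_eval_zero [simp]: "free_eval scale x 0 = 0"
  by (simp add: free_eval_def)

lemma free_eval_mult: "free_eval scale x (a * b) = free_eval scale x a * free_eval scale x b"
proof (induction a rule: poly_mapping_single_add_induct)
  case (single u c)
  show ?case
  proof (induction b rule: poly_mapping_single_add_induct)
    case (single v d)
    show ?case
      by (simp add: mult_single free_eval_single plus_word_def scale_mult_left scale_mult_right)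
  qed (simp_all add: free_eval_add distrib_left)
qed (simp_all add: free_eval_add distrib_right)

lemma free_eval_diff: "free_eval scale x (a - b) = free_eval scale x a - free_eval scale x b"
  using free_eval_add[of x "a - b" b] by simp

lemma free_eval_scale: "free_eval scale x (free_scale c a) = scale c (free_eval scale x a)"
  by (simp add: free_scale_def free_eval_mult free_eval_single zero_word_def scale_mult_left)

lemma free_eval_gen: "free_eval scale x (free_gen g) = x g"
  by (simp add: free_gen_def free_eval_single)

lemma free_eval_one: "free_eval scale x 1 = 1"
  by (simp add: free_eval_single zero_word_def flip: single_one)

lemma free_eval_sum: "free_eval scale x (sum f S) = (\<Sum>i\<in>S. free_eval scale x (f i))"
  by (induction S rule: infinite_finite_induct) (auto simp: free_eval_add)

text \<open>The difference of the two sides is reached from 0 by one step of the ideal with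
  cofactors 1, so evaluation kills it.\<close>

lemma presented_by_relation:
  assumes "presented_by scale G x R" "(a, b) \<in> R" "a \<in> free_on G" "b \<in> free_on G"
  shows "free_eval scale x a = free_eval scale x b"
proof -
  have "0 + 1 * (a - b) * 1 \<in> rel_ideal G R"
    using assms(2) by (intro rel_ideal.step rel_ideal.zero) auto
  then have "free_eval scale x (a - b) = 0"
    using assms(1) free_on_diff[OF assms(3,4)] unfolding presented_by_def by auto
  then show ?thesis
    by (simp add: free_eval_diff)
qed

end

section \<open>Transport of the defining relations along maps\<close>

lemma image_setcompr2: "F ` {f i j | i j. P i j} = {F (f i j) | i j. P i j}"
  and image_setcompr3: "F ` {f' i j k | i j k. P' i j k} = {F (f' i j k) | i j k. P' i j k}"
  and image_setcompr4:
    "F ` {f'' i j k l | i j k l. P'' i j k l} = {F (f'' i j k l) | i j k l. P'' i j k l}"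
  by blast+

text \<open>The relations are built from products, differences, scalar multiples and zero only. The
  lemma serves both for \<open>free_eval\<close> and for the map \<open>\<iota>\<close> into the
  extension.\<close>

lemma manin_rels_map:
  assumes hm: "\<And>a b. h (a * b) = h a * h b" and hd: "\<And>a b. h (a - b) = h a - h b"
    and hs: "\<And>c a. h (sA c a) = sB c (h a)" and h0: "h 0 = 0"
  shows "manin_rels sB q m n (\<lambda>i j. h (A i j)) = map_prod h h ` manin_rels sA q m n A"
  unfolding manin_rels_def Let_def image_Un image_setcompr2 image_setcompr3 image_setcompr4
    map_prod_simp hm hd hs h0 ..

lemma inverse_rels_map:
  assumes hm: "\<And>a b. h (a * b) = h a * h b"
    and hsum: "\<And>f S. h (sum f S) = (\<Sum>i\<in>(S :: nat set). h (f i))" and h0: "h 0 = 0" and h1: "h 1 = 1"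
  shows "inverse_rels N (\<lambda>i j. h (A i j)) (\<lambda>i j. h (B i j)) = map_prod h h ` inverse_rels N A B"
  unfolding inverse_rels_def image_Un image_setcompr2 map_prod_simp hm hsum if_distrib[of h] h0 h1 ..

lemma manin_rels_free_on:
  assumes "\<And>i j. i \<in> {1..m+n} \<Longrightarrow> j \<in> {1..m+n} \<Longrightarrow> A i j \<in> free_on G"
  shows "manin_rels free_scale q m n A \<subseteq> free_on G \<times> free_on G"
  unfolding manin_rels_def Let_def
  by (intro Un_least; clarify;
      intro conjI free_on_mult free_on_diff free_on_scale free_on_zero assms; assumption)

lemma free_on_if: "a \<in> free_on G \<Longrightarrow> b \<in> free_on G \<Longrightarrow> (if P then a else b) \<in> free_on G"
  by simp

lemma inverse_rels_free_on:
  assumes "\<And>i j. i \<in> {1..N} \<Longrightarrow> j \<in> {1..N} \<Longrightarrow> A i j \<in> free_on G"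
    and "\<And>i j. i \<in> {1..N} \<Longrightarrow> j \<in> {1..N} \<Longrightarrow> B i j \<in> free_on G"
  shows "inverse_rels N A B \<subseteq> free_on G \<times> free_on G"
  unfolding inverse_rels_def
  by (intro Un_least; clarify; intro conjI free_on_mult free_on_sum assms free_on_if;
      (assumption | rule free_on_one free_on_zero))

text \<open>A presentation speaks about formal generators; pushing its relations forward along
  \<open>free_eval\<close> gives exactly the relations of the two matrices.\<close>

lemma is_Mtilde_tilde_pair:
  assumes "is_Mtilde q m n scale part M Minv"
  shows "tilde_pair scale part q m n M Minv"
proof -
  interpret superalgebra scale part
    using assms unfolding is_Mtilde_def by simp
  let ?x = "case_gen M Minv"
  let ?h = "free_eval scale ?x"
  let ?A = "\<lambda>i j. free_gen (Ent i j)" and ?B = "\<lambda>i j. free_gen (InvEnt i j)"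
  let ?R = "tilde_rels free_scale q m n ?A ?B"
  have A: "?A i j \<in> free_on (gens (m + n))" "?B i j \<in> free_on (gens (m + n))"
    if "i \<in> {1..m+n}" "j \<in> {1..m+n}" for i j
    using that by (auto simp: gens_def intro!: free_on_gen)
  have "?R \<subseteq> free_on (gens (m + n)) \<times> free_on (gens (m + n))"
    unfolding tilde_rels_def supertranspose_def using A
    by (intro Un_least manin_rels_free_on inverse_rels_free_on free_on_scale)
  moreover have "presented_by scale (gens (m + n)) ?x ?R"
    using assms unfolding is_Mtilde_def by simp
  ultimately have R: "?h a = ?h b" if "(a, b) \<in> ?R" for a b
    using that by (intro presented_by_relation) (assumption | drule (1) subsetD, simp)+
  \<comment> \<open>These equations hold at all indices, so whole matrices can be rewritten as
    images under evaluation.\<close>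
  have st: "supertranspose scale m M = (\<lambda>i j. ?h (supertranspose free_scale m ?A i j))"
    "supertranspose scale m Minv = (\<lambda>i j. ?h (supertranspose free_scale m ?B i j))"
    and ent: "M = (\<lambda>i j. ?h (?A i j))" "Minv = (\<lambda>i j. ?h (?B i j))"
    by (simp_all add: fun_eq_iff supertranspose_def free_eval_scale free_eval_gen)
  note mm = manin_rels_map[of ?h free_scale scale,
      OF free_eval_mult free_eval_diff free_eval_scale free_eval_zero]
    and im = inverse_rels_map[of ?h,
      OF free_eval_mult free_eval_sum free_eval_zero free_eval_one]
  have eq: "tilde_rels scale q m n M Minv = map_prod ?h ?h ` ?R"
    unfolding tilde_rels_def image_Un st mm[symmetric] im[symmetric]
    by (simp only: ent[symmetric])
  have "\<forall>(a, b) \<in> tilde_rels scale q m n M Minv. a = b"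
    unfolding eq by (clarsimp simp only: map_prod_simp prod.case dest!: R)
  then show ?thesis
    using assms unfolding tilde_pair_def is_Mtilde_def by (elim conjE) (intro conjI)
qed

section \<open>The quantum exterior algebra\<close>

lemma inversions_cong:
  assumes "\<And>i. i \<in> {1..r} \<Longrightarrow> \<sigma> i = \<tau> i"
  shows "inversions r \<sigma> = inversions r \<tau>"
  unfolding inversions_def using assms by (intro arg_cong[where f = card]) auto

lemma inversions_zero: "inversions 0 \<sigma> = 0"
  unfolding inversions_def by (auto simp: card_eq_0_iff)

text \<open>An inversion either has both positions in \<open>{1..r}\<close> or has
  \<open>Suc r\<close> as its second position.\<close>

lemma inversions_Suc:
  "inversions (Suc r) \<sigma> = inversions r \<sigma> + card {i \<in> {1..r}. \<sigma> (Suc r) < \<sigma> i}"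
proof -
  let ?A = "{(i, j). 1 \<le> i \<and> i < j \<and> j \<le> r \<and> \<sigma> j < \<sigma> i}"
  let ?B = "{i \<in> {1..r}. \<sigma> (Suc r) < \<sigma> i}"
  have "?A \<subseteq> {..r} \<times> {..r}"
    by auto
  then have "finite ?A"
    by (rule finite_subset) auto
  moreover have "{(i, j). 1 \<le> i \<and> i < j \<and> j \<le> Suc r \<and> \<sigma> j < \<sigma> i} = ?A \<union> (\<lambda>i. (i, Suc r)) ` ?B"
    by (auto simp: le_Suc_eq)
  moreover have "card ((\<lambda>i. (i, Suc r)) ` ?B) = card ?B"
    by (intro card_image inj_onI) auto
  moreover have "card (?A \<union> (\<lambda>i. (i, Suc r)) ` ?B) = card ?A + card ((\<lambda>i. (i, Suc r)) ` ?B)"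
    using \<open>finite ?A\<close> by (intro card_Un_disjoint) auto
  ultimately show ?thesis
    unfolding inversions_def by simp
qed

text \<open>Permutations are handled as words, because deleting the last letter leaves a word over
  an arbitrary finite set, as the recursion of \<open>wedge\<close> requires. The shift
  \<open>i - 1\<close> reconciles positions from 1 with list indices from 0.\<close>

definition list_inversions :: "nat list \<Rightarrow> nat" where
  "list_inversions xs = inversions (length xs) (\<lambda>i. xs ! (i - 1))"

text \<open>Since the letters of \<open>xs\<close> are distinct, the inversions created by the last
  letter can be counted by values instead of positions.\<close>

lemma list_inversions_snoc:
  assumes "distinct xs"
  shows "list_inversions (xs @ [x]) = list_inversions xs + card {y \<in> set xs. x < y}"
proof -
  let ?\<sigma> = "\<lambda>i. (xs @ [x]) ! (i - 1)"
  let ?B = "{i \<in> {1..length xs}. ?\<sigma> (Suc (length xs)) < ?\<sigma> i}"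
  have \<sigma>: "?\<sigma> i = xs ! (i - 1)" if "i \<in> {1..length xs}" for i
    using that by (auto simp: nth_append)
  have "bij_betw (\<lambda>i. xs ! (i - 1)) ?B {y \<in> set xs. x < y}"
  proof (rule bij_betwI')
    fix i j assume "i \<in> ?B" "j \<in> ?B"
    then have "1 \<le> i" "i \<le> length xs" "1 \<le> j" "j \<le> length xs"
      by simp_all
    then show "xs ! (i - 1) = xs ! (j - 1) \<longleftrightarrow> i = j"
      using nth_eq_iff_index_eq[OF assms, of "i - 1" "j - 1"] by simp arith
  next
    fix i assume "i \<in> ?B"
    then show "xs ! (i - 1) \<in> {y \<in> set xs. x < y}"
      using \<sigma>[of i] by (auto intro!: nth_mem)
  next
    fix y assume "y \<in> {y \<in> set xs. x < y}"
    then obtain i where "i < length xs" "xs ! i = y" "x < y"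
      by (auto simp: in_set_conv_nth)
    then show "\<exists>i\<in>?B. y = xs ! (i - 1)"
      by (intro bexI[where x = "Suc i"]) (simp_all add: nth_append)
  qed
  then have "card ?B = card {y \<in> set xs. x < y}"
    by (rule bij_betw_same_card)
  moreover have "inversions (length xs) ?\<sigma> = list_inversions xs"
    unfolding list_inversions_def by (rule inversions_cong) (rule \<sigma>)
  ultimately show ?thesis
    unfolding list_inversions_def[of "xs @ [x]"] length_append_singleton inversions_Suc by simp
qed

lemma list_inversions_map:
  "list_inversions (map \<sigma> [1..<Suc r]) = inversions r \<sigma>"
  unfolding list_inversions_def by (auto intro!: inversions_cong simp del: upt_Suc)

text \<open>A permutation fixes everything outside \<open>{1..r}\<close>, hence is determined by its
  word. Surjectivity follows by counting.\<close>

lemma bij_betw_permutes_permutations_of_set: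
  "bij_betw (\<lambda>\<sigma>. map \<sigma> [1..<Suc r]) {\<sigma>. \<sigma> permutes {1..r}} (permutations_of_set {1..r})"
proof -
  let ?f = "\<lambda>\<sigma>. map \<sigma> [1..<Suc r]"
  have inj: "inj_on ?f {\<sigma>. \<sigma> permutes {1..r}}"
  proof (rule inj_onI)
    fix \<sigma> \<tau> assume *: "\<sigma> \<in> {\<sigma>. \<sigma> permutes {1..r}}" "\<tau> \<in> {\<sigma>. \<sigma> permutes {1..r}}" "?f \<sigma> = ?f \<tau>"
    then have "\<sigma> i = \<tau> i" for i
      by (cases "i \<in> {1..r}") (auto simp: permutes_not_in simp del: upt_Suc)
    then show "\<sigma> = \<tau>"
      by blast
  qed
  have "?f ` {\<sigma>. \<sigma> permutes {1..r}} \<subseteq> permutations_of_set {1..r}"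
  proof (intro image_subsetI permutations_of_setI)
    fix \<sigma> assume "\<sigma> \<in> {\<sigma>. \<sigma> permutes {1..r}}"
    then have p: "\<sigma> permutes {1..r}"
      by simp
    have "set (?f \<sigma>) = \<sigma> ` {1..r}"
      by (simp add: atLeastLessThanSuc_atLeastAtMost del: upt_Suc)
    then show "set (?f \<sigma>) = {1..r}"
      using permutes_image[OF p] by simp
    show "distinct (?f \<sigma>)"
      using permutes_inj_on[OF p] by (simp add: distinct_map del: upt_Suc)
  qed
  moreover have "card (?f ` {\<sigma>. \<sigma> permutes {1..r}}) = card (permutations_of_set {1..r})"
    using card_image[OF inj] by (simp add: card_permutations del: upt_Suc)
  ultimately have "?f ` {\<sigma>. \<sigma> permutes {1..r}} = permutations_of_set {1..r}"
    by (intro card_subset_eq) simp_all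
  then show ?thesis
    using inj by (simp add: bij_betw_def)
qed

text \<open>A word using each element of \<open>I\<close> once is a last letter \<open>i\<close>
  preceded by such a word for \<open>I - {i}\<close>. The resulting double sum has the shape of
  \<open>wedge\<close>.\<close>

lemma sum_permutations_of_set_snoc:
  assumes "finite I" "I \<noteq> {}"
  shows "(\<Sum>xs\<in>permutations_of_set I. f xs) =
    (\<Sum>i\<in>I. \<Sum>xs\<in>permutations_of_set (I - {i}). f (xs @ [i]))"
proof -
  let ?S = "Sigma I (\<lambda>i. permutations_of_set (I - {i}))"
  have "inj_on (\<lambda>a. snd a @ [fst a]) ?S"
    by (rule inj_onI) (simp add: prod_eq_iff)
  moreover have "(\<lambda>a. snd a @ [fst a]) ` ?S = permutations_of_set I"
  proof (intro equalityI subsetI)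
    fix xs assume "xs \<in> permutations_of_set I"
    then have xs: "set xs = I" "distinct xs"
      by (simp_all add: permutations_of_set_def)
    then obtain ys y where ys: "xs = ys @ [y]"
      using assms(2) by (cases xs rule: rev_cases) simp_all
    have "set ys = I - {y}" "distinct ys" "y \<in> I"
      using xs unfolding ys by force+
    then have "(y, ys) \<in> ?S"
      by (simp add: permutations_of_set_def)
    then show "xs \<in> (\<lambda>a. snd a @ [fst a]) ` ?S"
      unfolding ys by (rule rev_image_eqI) simp
  next
    fix xs assume "xs \<in> (\<lambda>a. snd a @ [fst a]) ` ?S"
    then obtain i ys where "xs = ys @ [i]" "i \<in> I" "set ys = I - {i}" "distinct ys"
      by (auto simp: permutations_of_set_def)
    then show "xs \<in> permutations_of_set I"
      by (simp add: permutations_of_set_def insert_absorb)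
  qed
  ultimately have "(\<Sum>xs\<in>permutations_of_set I. f xs) = (\<Sum>a\<in>?S. f (snd a @ [fst a]))"
    by (metis (no_types, lifting) sum.reindex_cong)
  also have "\<dots> = (\<Sum>i\<in>I. \<Sum>xs\<in>permutations_of_set (I - {i}). f (xs @ [i]))"
    using assms(1) by (simp add: sum.Sigma case_prod_unfold)
  finally show ?thesis .
qed

section \<open>Products of vectors in the quantum exterior algebra\<close>

context superalgebra
begin

text \<open>
  A function \<open>F\<close> on finite sets of indices stands for the element \<open>\<Sum>I. F I e\<^sub>I\<close> of the quantum
  exterior algebra with \<open>e\<^sub>i\<^sup>2 = 0\<close> and \<open>e\<^sub>j e\<^sub>i = p e\<^sub>i e\<^sub>j\<close> for \<open>i < j\<close>, whose generators commute
  with the coefficients; \<open>wedge p F v\<close> is its product with the vector \<open>\<Sum>i. v i e\<^sub>i\<close>.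
\<close>

definition wedge :: "'k \<Rightarrow> (nat set \<Rightarrow> 'a) \<Rightarrow> (nat \<Rightarrow> 'a) \<Rightarrow> nat set \<Rightarrow> 'a" where
  "wedge p F v I = (\<Sum>i\<in>I. scale (p ^ card {j\<in>I. i < j}) (F (I - {i}) * v i))"

abbreviation wedge_one :: "nat set \<Rightarrow> 'a" where
  "wedge_one \<equiv> (\<lambda>I. if I = {} then 1 else 0)"

abbreviation wedges :: "'k \<Rightarrow> (nat set \<Rightarrow> 'a) \<Rightarrow> (nat \<Rightarrow> 'a) list \<Rightarrow> nat set \<Rightarrow> 'a" where
  "wedges p \<equiv> foldl (wedge p)"

lemma wedge_cong:
  assumes "\<And>J. J \<subseteq> I \<Longrightarrow> F J = G J" "\<And>i. i \<in> I \<Longrightarrow> v i = w i"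
  shows "wedge p F v I = wedge p G w I"
  unfolding wedge_def by (intro sum.cong) (use assms in auto)

lemma wedge_add: "wedge p F (\<lambda>i. v i + w i) I = wedge p F v I + wedge p F w I"
  unfolding wedge_def by (simp add: distrib_left scale_right_distrib sum.distrib)

lemma wedge_zero: "wedge p F (\<lambda>i. 0) I = 0"
  unfolding wedge_def by simp

lemma wedge_mult_right: "wedge p F (\<lambda>i. v i * c) I = wedge p F v I * c"
  unfolding wedge_def by (simp add: sum_distrib_right scale_mult_left mult.assoc)

lemma wedge_sum: "wedge p F (\<lambda>i. \<Sum>s\<in>S. v s i) I = (\<Sum>s\<in>S. wedge p F (v s) I)"
  by (induction S rule: infinite_finite_induct) (simp_all add: wedge_add wedge_zero)

text \<open>The two vectors supply indices \<open>a < b\<close> in either order, and the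
  out-of-order term carries one more factor \<open>p\<close>. Hence the product depends on
  \<open>v\<close> and \<open>w\<close> only through their 2 by 2 quantum minors.\<close>

lemma wedge_wedge:
  assumes "finite I"
  shows "wedge p (wedge p F v) w I =
    (\<Sum>(a, b) | a \<in> I \<and> b \<in> I \<and> a < b.
      scale (p ^ (card {j\<in>I - {b}. a < j} + card {j\<in>I. b < j}))
        (F (I - {a, b}) * (v a * w b + scale p (v b * w a))))"
proof -
  let ?n = "\<lambda>a. card {j\<in>I. a < j}"
  let ?T = "\<lambda>b a. scale (p ^ (?n b + card {j\<in>I - {b}. a < j})) (F (I - {b} - {a}) * v a * w b)"
  let ?U = "{(a, b). a \<in> I \<and> b \<in> I \<and> a < b}"
  have fin: "finite ?U"
    by (rule finite_subset[of _ "I \<times> I"]) (use assms in auto)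
  have "wedge p (wedge p F v) w I = (\<Sum>b\<in>I. \<Sum>a\<in>I - {b}. ?T b a)"
    unfolding wedge_def
    by (simp add: scale_sum_right sum_distrib_right scale_mult_left power_add mult.assoc)
  also have "\<dots> = (\<Sum>(b, a)\<in>Sigma I (\<lambda>b. I - {b}). ?T b a)"
    using assms by (subst sum.Sigma) auto
  \<comment> \<open>Ordered pairs of distinct indices are the increasing ones and their reversals;
    the two halves are then added pairwise.\<close>
  also have "Sigma I (\<lambda>b. I - {b}) = prod.swap ` ?U \<union> ?U"
    by (auto simp: image_iff)
  also have "(\<Sum>(b, a)\<in>prod.swap ` ?U \<union> ?U. ?T b a) =
      (\<Sum>(b, a)\<in>prod.swap ` ?U. ?T b a) + (\<Sum>(b, a)\<in>?U. ?T b a)"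
    using fin by (intro sum.union_disjoint) auto
  also have "(\<Sum>(b, a)\<in>prod.swap ` ?U. ?T b a) = (\<Sum>(a, b)\<in>?U. ?T b a)"
    by (subst sum.reindex) (auto simp: case_prod_unfold intro!: inj_onI)
  also have "\<dots> + (\<Sum>(b, a)\<in>?U. ?T b a) = (\<Sum>(a, b)\<in>?U. ?T b a + ?T a b)"
    by (simp add: sum.distrib case_prod_unfold)
  also have "\<dots> = (\<Sum>(a, b)\<in>?U. scale (p ^ (card {j\<in>I - {b}. a < j} + ?n b))
        (F (I - {a, b}) * (v a * w b + scale p (v b * w a))))"
  proof (intro sum.cong refl, clarify)
    fix a b assume ab: "a \<in> I" "b \<in> I" "a < b"
    \<comment> \<open>The count for \<open>a\<close> in \<open>I\<close> includes \<open>b\<close>,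
      the one in \<open>I - {b}\<close> does not: hence the extra factor \<open>p\<close>.\<close>
    have "{j\<in>I. a < j} = insert b {j\<in>I - {b}. a < j}"
      using ab by auto
    then have n: "?n a = Suc (card {j\<in>I - {b}. a < j})"
      using assms by simp
    have e: "{j\<in>I - {a}. b < j} = {j\<in>I. b < j}" "I - {b} - {a} = I - {a, b}" "I - {a} - {b} = I - {a, b}"
      using ab by auto
    show "?T b a + ?T a b = scale (p ^ (card {j\<in>I - {b}. a < j} + ?n b))
        (F (I - {a, b}) * (v a * w b + scale p (v b * w a)))"
      unfolding n e by (simp add: distrib_left scale_right_distrib scale_mult_right mult.assoc power_add
          ac_simps)
  qed
  finally show ?thesis .
qed

lemma wedge_square:
  assumes "finite I" "\<And>a b. a \<in> I \<Longrightarrow> b \<in> I \<Longrightarrow> a < b \<Longrightarrow> v a * v b + scale p (v b * v a) = 0"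
  shows "wedge p (wedge p F v) v I = 0"
  unfolding wedge_wedge[OF assms(1)]
proof (intro sum.neutral ballI, clarify)
  fix a b assume ab: "a \<in> I" "b \<in> I" "a < b"
  show "scale (p ^ (card {j\<in>I - {b}. a < j} + card {j\<in>I. b < j}))
      (F (I - {a, b}) * (v a * v b + scale p (v b * v a))) = 0"
    unfolding assms(2)[OF ab] by simp
qed

text \<open>Proportional minors give proportional products, by \<open>wedge_wedge\<close>. This
  turns relations between matrix entries into q-anticommutation of columns.\<close>

lemma wedge_commute:
  assumes "finite I" "\<And>a b. a \<in> I \<Longrightarrow> b \<in> I \<Longrightarrow> a < b \<Longrightarrow>
      v a * w b + scale p (v b * w a) = scale c (w a * v b + scale p (w b * v a))"
  shows "wedge p (wedge p F v) w I = scale c (wedge p (wedge p F w) v I)"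
  unfolding wedge_wedge[OF assms(1)] scale_sum_right
proof (intro sum.cong refl, clarify)
  fix a b assume ab: "a \<in> I" "b \<in> I" "a < b"
  show "scale (p ^ (card {j\<in>I - {b}. a < j} + card {j\<in>I. b < j}))
      (F (I - {a, b}) * (v a * w b + scale p (v b * w a))) =
    scale c (scale (p ^ (card {j\<in>I - {b}. a < j} + card {j\<in>I. b < j}))
      (F (I - {a, b}) * (w a * v b + scale p (w b * v a))))"
    unfolding assms(2)[OF ab] scale_mult_right by (rule scale_left_commute)
qed

text \<open>Induction on the last vector: if it supplies the index \<open>i\<close>, its exponent
  counts the elements of \<open>I\<close> above \<open>i\<close>, which are exactly the inversions
  made by appending \<open>i\<close>.\<close>

lemma wedges_expand:
  assumes "finite I" "card I = length vs"
  shows "wedges p wedge_one vs I = (\<Sum>xs\<in>permutations_of_set I.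
    scale (p ^ list_inversions xs) (prod_list (map2 (\<lambda>v i. v i) vs xs)))"
  using assms
proof (induction vs arbitrary: I rule: rev_induct)
  case Nil
  then show ?case
    by (simp add: list_inversions_def inversions_zero)
next
  case (snoc v vs)
  let ?t = "\<lambda>vs xs. scale (p ^ list_inversions xs) (prod_list (map2 (\<lambda>v i. v i) vs xs))"
  have step: "scale (p ^ card {j\<in>I. i < j}) (wedges p wedge_one vs (I - {i}) * v i) =
        (\<Sum>xs\<in>permutations_of_set (I - {i}). ?t (vs @ [v]) (xs @ [i]))"
    if i: "i \<in> I" for i
  proof -
    have fin: "finite (I - {i})" and card: "card (I - {i}) = length vs"
      using snoc.prems i by simp_all
    have snoc_term: "?t (vs @ [v]) (xs @ [i]) = scale (p ^ card {j\<in>I. i < j}) (?t vs xs * v i)"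
      if "xs \<in> permutations_of_set (I - {i})" for xs
    proof -
      have xs: "set xs = I - {i}" "distinct xs"
        using that by (simp_all add: permutations_of_set_def)
      \<comment> \<open>Equal lengths are what lets the zipped list split at its last pair.\<close>
      then have len: "length xs = length vs"
        using card distinct_card[OF xs(2)] by simp
      have "{y \<in> set xs. i < y} = {j\<in>I. i < j}"
        unfolding xs by blast
      then have "list_inversions (xs @ [i]) = list_inversions xs + card {j\<in>I. i < j}"
        by (simp only: list_inversions_snoc[OF xs(2)])
      then show ?thesis
        using len by (simp add: power_add scale_mult_left mult.commute)
    qed
    have "scale (p ^ card {j\<in>I. i < j}) (wedges p wedge_one vs (I - {i}) * v i) =
        (\<Sum>xs\<in>permutations_of_set (I - {i}). scale (p ^ card {j\<in>I. i < j}) (?t vs xs * v i))"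
      by (simp only: snoc.IH[OF fin card] sum_distrib_right scale_sum_right)
    also have "\<dots> = (\<Sum>xs\<in>permutations_of_set (I - {i}). ?t (vs @ [v]) (xs @ [i]))"
      by (intro sum.cong refl snoc_term[symmetric])
    finally show ?thesis .
  qed
  have "wedges p wedge_one (vs @ [v]) I =
      (\<Sum>i\<in>I. scale (p ^ card {j\<in>I. i < j}) (wedges p wedge_one vs (I - {i}) * v i))"
    by (simp only: foldl_append foldl_Cons foldl_Nil wedge_def[of _ _ v])
  also have "\<dots> = (\<Sum>i\<in>I. \<Sum>xs\<in>permutations_of_set (I - {i}). ?t (vs @ [v]) (xs @ [i]))"
    by (intro sum.cong refl step)
  also have "\<dots> = (\<Sum>xs\<in>permutations_of_set I. ?t (vs @ [v]) xs)"
    using snoc.prems by (intro sum_permutations_of_set_snoc[symmetric]) auto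
  finally show ?case .
qed

text \<open>With base \<open>inverse (- q)\<close> the inversion weights are those of the
  determinant, which is thus the top coefficient of the product of the columns.\<close>

lemma wedges_eq_qdet:
  "wedges (inverse (- q)) wedge_one (map (\<lambda>j i. A i j) [1..<Suc r]) {1..r} = qdet scale q r A"
proof -
  have "wedges (inverse (- q)) wedge_one (map (\<lambda>j i. A i j) [1..<Suc r]) {1..r} =
      (\<Sum>\<sigma> | \<sigma> permutes {1..r}. scale (inverse (- q) ^ list_inversions (map \<sigma> [1..<Suc r]))
        (prod_list (map2 (\<lambda>v i. v i) (map (\<lambda>j i. A i j) [1..<Suc r]) (map \<sigma> [1..<Suc r]))))"
    by (subst wedges_expand;
        (rule sum.reindex_bij_betw[OF bij_betw_permutes_permutations_of_set, symmetric] | simp))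
  also have "\<dots> = qdet scale q r A"
    unfolding qdet_def list_inversions_map
    by (intro sum.cong refl)
      (simp add: power_int_minus power_inverse zip_map_map zip_same_conv_map comp_def
        del: upt_Suc inverse_minus_eq)
  finally show ?thesis .
qed

end

lemma eq_if_mem_rels: "\<forall>(a, b) \<in> R. a = b \<Longrightarrow> (x, y) \<in> R \<Longrightarrow> x = y"
  by (drule (1) bspec) (simp only: prod.case)

lemma map_plus_upt: "map ((+) k) [a..<b] = [k + a..<k + b]"
  by (induction b) auto

section \<open>Column operations and block form\<close>

context superalgebra
begin

lemma wedge_zero_left: "wedge p (\<lambda>_. 0) v I = 0"
  unfolding wedge_def by simp

lemma wedges_cong:
  assumes "\<And>j i. j \<in> set js \<Longrightarrow> i \<in> I \<Longrightarrow> f j i = g j i"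
  shows "wedges p F (map f js) I = wedges p F (map g js) I"
  using assms
proof (induction js arbitrary: I rule: rev_induct)
  case (snoc j js)
  then show ?case
    by (auto intro!: wedge_cong)
qed simp

text \<open>The final column \<open>s\<close> is moved left past the others, at the cost of scalars
  \<open>c\<close>, until it meets an equal column, where the square vanishes.\<close>

lemma wedges_repeated_column:
  assumes square: "\<And>a b j. a \<in> R \<Longrightarrow> b \<in> R \<Longrightarrow> a < b \<Longrightarrow> j \<in> J \<Longrightarrow>
      A a j * A b j + scale p (A b j * A a j) = 0"
    and commute: "\<And>a b j l. a \<in> R \<Longrightarrow> b \<in> R \<Longrightarrow> a < b \<Longrightarrow> j \<in> J \<Longrightarrow> l \<in> J \<Longrightarrow> j \<noteq> l \<Longrightarrow>
      A a j * A b l + scale p (A b j * A a l) = scale (c j l) (A a l * A b j + scale p (A b l * A a j))"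
    and R: "finite R"
    and "set js \<subseteq> J" "s \<in> set js" "I \<subseteq> R"
  shows "wedge p (wedges p F (map (\<lambda>j i. A i j) js)) (\<lambda>i. A i s) I = 0"
  using assms(4-)
proof (induction js arbitrary: I rule: rev_induct)
  case (snoc t js)
  have I: "finite I" "\<And>a. a \<in> I \<Longrightarrow> a \<in> R"
    using snoc.prems R finite_subset by auto
  let ?W = "wedges p F (map (\<lambda>j i. A i j) js)"
  have "wedge p (wedge p ?W (\<lambda>i. A i t)) (\<lambda>i. A i s) I = 0"
  proof (cases "s = t")
    case True
    then show ?thesis
      using I snoc.prems by (auto intro!: wedge_square square)
  next
    case False
    have "wedge p (wedge p ?W (\<lambda>i. A i t)) (\<lambda>i. A i s) I =
        scale (c t s) (wedge p (wedge p ?W (\<lambda>i. A i s)) (\<lambda>i. A i t) I)"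
      using I snoc.prems False by (intro wedge_commute commute) auto
    also have "wedge p (wedge p ?W (\<lambda>i. A i s)) (\<lambda>i. A i t) I = wedge p (\<lambda>_. 0) (\<lambda>i. A i t) I"
      using snoc.prems False by (intro wedge_cong snoc.IH) auto
    finally show ?thesis
      by (simp only: wedge_zero_left scale_zero_right)
  qed
  then show ?case
    by simp
qed simp

text \<open>A multiplier stands to the right of its column, so it can be pulled out when that column
  is the last factor; what remains repeats a column of \<open>ks\<close> and vanishes.\<close>

lemma wedges_column_operations:
  assumes dependent: "\<And>js s I. set js \<subseteq> J \<Longrightarrow> s \<in> set js \<Longrightarrow> I \<subseteq> R \<Longrightarrow>
      wedge p (wedges p F (map (\<lambda>j i. A i j) js)) (\<lambda>i. A i s) I = 0"
    and g: "\<And>i j. i \<in> R \<Longrightarrow> j \<in> set js \<Longrightarrow> g j i = A i j + (\<Sum>s\<in>set ks. A i s * c s j)"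
    and "set ks \<subseteq> J" "set js \<subseteq> J" "I \<subseteq> R"
  shows "wedges p F (map (\<lambda>j i. A i j) ks @ map g js) I = wedges p F (map (\<lambda>j i. A i j) (ks @ js)) I"
  using assms(2-)
proof (induction js arbitrary: I rule: rev_induct)
  case (snoc t js)
  let ?W = "wedges p F (map (\<lambda>j i. A i j) (ks @ js))"
  have "wedges p F (map (\<lambda>j i. A i j) ks @ map g (js @ [t])) I =
      wedge p (wedges p F (map (\<lambda>j i. A i j) ks @ map g js)) (g t) I"
    by simp
  \<comment> \<open>The induction hypothesis first restores the original columns before the last
    one, so that \<open>dependent\<close> applies to them.\<close>
  also have "\<dots> = wedge p ?W (\<lambda>i. A i t + (\<Sum>s\<in>set ks. A i s * c s t)) I"
    using snoc.prems by (intro wedge_cong snoc.IH) auto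
  also have "\<dots> = wedge p ?W (\<lambda>i. A i t) I"
    using snoc.prems by (simp add: wedge_add wedge_sum wedge_mult_right dependent del: map_append)
  finally show ?case
    by simp
qed simp

text \<open>The vectors vanish on \<open>K\<close>, so all indices they supply come from
  \<open>J\<close> and \<open>F\<close> is evaluated at \<open>K\<close>. As \<open>K\<close> lies
  below \<open>J\<close>, the exponents count elements of \<open>J\<close> only.\<close>

lemma wedges_Un:
  assumes "\<And>l i. l \<in> set ls \<Longrightarrow> i \<in> K \<Longrightarrow> g l i = 0"
    and "\<And>i j. i \<in> K \<Longrightarrow> j \<in> J \<Longrightarrow> i < j"
    and "finite K" "finite J" "card J = length ls"
  shows "wedges p F (map g ls) (K \<union> J) = F K * wedges p wedge_one (map g ls) J"
  using assms
proof (induction ls arbitrary: J rule: rev_induct)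
  case (snoc l ls)
  have "K \<inter> J = {}"
    using snoc.prems(2) by blast
  have g: "g l i = 0" if "i \<in> K" for i
    using snoc.prems(1) that by simp
  have step: "scale (p ^ card {j \<in> K \<union> J. i < j}) (wedges p F (map g ls) (K \<union> J - {i}) * g l i) =
      F K * scale (p ^ card {j \<in> J. i < j}) (wedges p wedge_one (map g ls) (J - {i}) * g l i)"
    if i: "i \<in> J" for i
  proof -
    have n: "{j \<in> K \<union> J. i < j} = {j \<in> J. i < j}"
      using snoc.prems(2) i by (auto dest: less_asym)
    have m: "K \<union> J - {i} = K \<union> (J - {i})"
      using \<open>K \<inter> J = {}\<close> i by blast
    have "wedges p F (map g ls) (K \<union> (J - {i})) = F K * wedges p wedge_one (map g ls) (J - {i})"
      using snoc.prems i by (intro snoc.IH) simp_all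
    then show ?thesis
      unfolding n m by (simp only: scale_mult_right mult.assoc)
  qed
  have "wedges p F (map g (ls @ [l])) (K \<union> J) =
      (\<Sum>i\<in>K \<union> J. scale (p ^ card {j \<in> K \<union> J. i < j}) (wedges p F (map g ls) (K \<union> J - {i}) * g l i))"
    by (simp only: map_append list.map foldl_append foldl_Cons foldl_Nil wedge_def[of _ _ "g l"])
  also have "\<dots> = (\<Sum>i\<in>J. scale (p ^ card {j \<in> K \<union> J. i < j})
      (wedges p F (map g ls) (K \<union> J - {i}) * g l i))"
    using g snoc.prems(3,4) by (intro sum.mono_neutral_right) auto
  also have "\<dots> = (\<Sum>i\<in>J. F K * scale (p ^ card {j \<in> J. i < j})
      (wedges p wedge_one (map g ls) (J - {i}) * g l i))"
    by (intro sum.cong refl step)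
  also have "\<dots> = F K * wedges p wedge_one (map g (ls @ [l])) J"
    by (simp only: map_append list.map foldl_append foldl_Cons foldl_Nil wedge_def[of _ _ "g l"]
        sum_distrib_left)
  finally show ?case .
qed simp

text \<open>A shift preserves the order of indices, hence all the exponents.\<close>

lemma wedges_shift:
  "wedges p wedge_one vs ((+) k ` J) = wedges p wedge_one (map (\<lambda>v i. v (k + i)) vs) J"
proof (induction vs arbitrary: J rule: rev_induct)
  case (snoc v vs)
  have step: "scale (p ^ card {j \<in> (+) k ` J. k + i < j}) (wedges p wedge_one vs ((+) k ` J - {k + i}) * v (k + i)) =
      scale (p ^ card {j \<in> J. i < j})
        (wedges p wedge_one (map (\<lambda>v i. v (k + i)) vs) (J - {i}) * v (k + i))" for i
  proof -
    have "{j \<in> (+) k ` J. k + i < j} = (+) k ` {j \<in> J. i < j}"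
      by auto
    moreover have "(+) k ` J - {k + i} = (+) k ` (J - {i})"
      by auto
    ultimately show ?thesis
      by (simp only: snoc.IH card_image[OF inj_on_add])
  qed
  have "wedges p wedge_one (vs @ [v]) ((+) k ` J) =
      (\<Sum>i\<in>J. scale (p ^ card {j \<in> (+) k ` J. k + i < j}) (wedges p wedge_one vs ((+) k ` J - {k + i}) * v (k + i)))"
    unfolding foldl_append foldl_Cons foldl_Nil wedge_def
    by (subst sum.reindex) (simp_all only: inj_on_add comp_def)
  also have "\<dots> = wedges p wedge_one (map (\<lambda>v i. v (k + i)) (vs @ [v])) J"
    unfolding step by (simp add: wedge_def)
  finally show ?case .
qed simp

section \<open>Manin relations between even indices and the block determinant\<close>

text \<open>In the third family of relations, even parities make the sign trivial, and
  \<open>i < j\<close> makes the exponent of \<open>q\<close> equal to -1.\<close>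

lemma manin_even_column:
  assumes A: "\<forall>(a, b) \<in> manin_rels scale q m n A. a = b"
    and "i \<in> {1..m}" "j \<in> {1..m}" "k \<in> {1..m}" "i < j"
  shows "A i k * A j k = scale (inverse q) (A j k * A i k)"
proof -
  have par: "par m i = 0" "par m j = 0" "par m k = 0" and eps: "eps i j = -1"
    using assms(2-) by (simp_all add: par_def eps_def)
  have "(A i k * A j k, scale (q powi eps i j * sg (par m i * par m j)) (A j k * A i k))
      \<in> manin_rels scale q m n A"
    unfolding manin_rels_def Let_def
    by (rule UnI1, rule UnI2, rule CollectI, rule exI[of _ i], rule exI[of _ j], rule exI[of _ k],
        intro conjI refl par(3))
      (use assms(2-4) in auto)
  from eq_if_mem_rels[OF A this] show ?thesis
    unfolding par eps by (simp add: sg_def power_int_minus)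
qed

text \<open>In the fourth family, \<open>i < k\<close> and \<open>j < l\<close> give exponents -1
  and 1. They cancel on the left, which leaves a plain commutator.\<close>

lemma manin_even_cross:
  assumes A: "\<forall>(a, b) \<in> manin_rels scale q m n A. a = b"
    and "i \<in> {1..m}" "j \<in> {1..m}" "k \<in> {1..m}" "l \<in> {1..m}" "i < k" "j < l"
  shows "A i j * A k l - A k l * A i j =
    scale (inverse q) (A k j * A i l) - scale q (A i l * A k j)"
proof -
  have par: "par m i = 0" "par m j = 0" "par m k = 0" "par m l = 0"
    and eps: "eps i k = -1" "eps l j = 1"
    using assms(2-) by (simp_all add: par_def eps_def)
  have "(A i j * A k l
            - scale (q powi (eps i k + eps l j) * sg ((par m i + par m j) * (par m k + par m l))) (A k l * A i j),
          scale (q powi eps i k * sg (par m i * par m k + par m j * par m k + par m i * par m j)) (A k j * A i l)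
            - scale (q powi eps l j * sg (par m j * par m k + par m j * par m l + par m k * par m l)) (A i l * A k j))
      \<in> manin_rels scale q m n A"
    unfolding manin_rels_def Let_def
    by (rule UnI2, rule CollectI, rule exI[of _ i], rule exI[of _ j], rule exI[of _ k], rule exI[of _ l],
        intro conjI refl)
      (use assms(2-5) in auto)
  from eq_if_mem_rels[OF A this] show ?thesis
    unfolding par eps sg_def by (simp only: add_0_left mult_zero_left mult_1_right if_True
        power_int_minus1_right power_int_1_right power_int_0_right minus_add_cancel scale_one refl
        ab_left_minus simp_thms)
qed

text \<open>Right combinations of the first \<open>k\<close> columns turn the later even columns
  into those of \<open>P\<close> below a zero block, without changing the product of all
  columns.\<close>

lemma qdet_block:
  assumes q: "q \<noteq> 0" and A: "\<forall>(a, b) \<in> manin_rels scale q (k + m) n A. a = b"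
    and P: "\<And>i j. i \<in> {1..k + m} \<Longrightarrow> j \<in> {1..m} \<Longrightarrow>
      A i (k + j) + (\<Sum>s=1..k. A i s * c s j) = (if i \<le> k then 0 else P (i - k) j)"
  shows "qdet scale q (k + m) A = qdet scale q k A * qdet scale q m P"
proof -
  define p where "p = inverse (- q)"
  let ?R = "{1..k + m}"
  let ?col = "\<lambda>j i. A i j"
  let ?ks = "[1..<Suc k]" and ?js = "map ((+) k) [1..<Suc m]"
  let ?g = "\<lambda>l i. if i \<le> k then 0 else P (i - k) (l - k)"
  \<comment> \<open>With \<open>p = inverse (- q)\<close> the column relation says that the minors
    of a column with itself vanish.\<close>
  have square: "A a j * A b j + scale p (A b j * A a j) = 0"
    if "a \<in> ?R" "b \<in> ?R" "a < b" "j \<in> ?R" for a b j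
    using manin_even_column[OF A that(1,2,4,3)] by (simp add: p_def)
  \<comment> \<open>Since \<open>- q * p = 1\<close>, the cross relation rearranges into
    proportionality of the minors of columns \<open>j\<close>, \<open>l\<close> and of
    \<open>l\<close>, \<open>j\<close>.\<close>
  have less: "A a j * A b l + scale p (A b j * A a l) = scale (- q) (A a l * A b j + scale p (A b l * A a j))"
    if "a \<in> ?R" "b \<in> ?R" "a < b" "j \<in> ?R" "l \<in> ?R" "j < l" for a b j l
    using manin_even_cross[OF A that(1,4,2,5,3,6)] q
    by (simp add: p_def scale_right_distrib algebra_simps)
  \<comment> \<open>For \<open>l < j\<close> the previous relation is read backwards, with the
    inverse factor \<open>p\<close>.\<close>
  have commute: "A a j * A b l + scale p (A b j * A a l) =
      scale (if j < l then - q else p) (A a l * A b j + scale p (A b l * A a j))"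
    if "a \<in> ?R" "b \<in> ?R" "a < b" "j \<in> ?R" "l \<in> ?R" "j \<noteq> l" for a b j l
  proof (cases "j < l")
    case True
    then show ?thesis
      using less that by simp
  next
    case False
    then have "scale p (A a l * A b j + scale p (A b l * A a j)) =
        scale p (scale (- q) (A a j * A b l + scale p (A b j * A a l)))"
      using less[of a b l j] that by simp
    also have "\<dots> = A a j * A b l + scale p (A b j * A a l)"
      unfolding scale_scale using q by (simp add: p_def)
    finally show ?thesis
      using False by simp
  qed
  note dependent = wedges_repeated_column[of ?R ?R, OF square commute finite_atLeastAtMost]
  have cols: "[1..<Suc (k + m)] = ?ks @ ?js"
    using upt_add_eq_append[of 1 "Suc k" m] by (simp add: map_plus_upt del: upt_Suc)
  have rows: "?R = {1..k} \<union> (+) k ` {1..m}"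
    by auto
  have ks: "set ?ks = {1..k}" and js: "set ?js = {k+1..k+m}"
    by (simp_all add: atLeastLessThanSuc_atLeastAtMost add.commute del: upt_Suc)
  have "qdet scale q (k + m) A = wedges p wedge_one (map ?col (?ks @ ?js)) ?R"
    unfolding cols[symmetric] p_def wedges_eq_qdet ..
  also have "\<dots> = wedges p wedge_one (map ?col ?ks @ map ?g ?js) ?R"
  \<comment> \<open>The later columns are numbered from \<open>k + 1\<close>, the multipliers from
    1.\<close>
  proof (rule wedges_column_operations[symmetric, where c = "\<lambda>s j. c s (j - k)"])
    fix i l assume *: "i \<in> ?R" "l \<in> set ?js"
    then obtain j where "l = k + j" "j \<in> {1..m}"
      by auto
    then show "?g l i = A i l + (\<Sum>s\<in>set ?ks. A i s * c s (l - k))"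
      using P[of i j] * unfolding ks by simp
  qed (use ks js in \<open>auto intro!: dependent simp del: upt_Suc\<close>)
  also have "\<dots> = wedges p (wedges p wedge_one (map ?col ?ks)) (map ?g ?js) ({1..k} \<union> (+) k ` {1..m})"
    unfolding rows by simp
  \<comment> \<open>The zero block occupies the rows \<open>{1..k}\<close>, which lie below all
    remaining row indices.\<close>
  also have "\<dots> = wedges p wedge_one (map ?col ?ks) {1..k} * wedges p wedge_one (map ?g ?js) ((+) k ` {1..m})"
    by (rule wedges_Un) (auto simp: card_image)
  also have "wedges p wedge_one (map ?g ?js) ((+) k ` {1..m}) = wedges p wedge_one (map (\<lambda>j i. ?g (k + j) (k + i)) [1..<Suc m]) {1..m}"
    unfolding wedges_shift by (simp add: comp_def del: upt_Suc)
  also have "\<dots> = wedges p wedge_one (map (\<lambda>j i. P i j) [1..<Suc m]) {1..m}"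
    by (intro wedges_cong) auto
  finally show ?thesis
    unfolding p_def wedges_eq_qdet .
qed

end

section \<open>Superalgebra homomorphisms and inverse matrices\<close>

lemma qdet_cong:
  assumes "\<And>i j. i \<in> {1..r} \<Longrightarrow> j \<in> {1..r} \<Longrightarrow> A i j = B i j"
  shows "qdet s q r A = qdet s q r B"
  unfolding qdet_def
proof (intro sum.cong refl arg_cong[where f = "s _"] arg_cong[where f = prod_list] map_cong)
  fix \<sigma> j assume "\<sigma> \<in> {\<sigma>. \<sigma> permutes {1..r}}" "j \<in> set [1..<Suc r]"
  then have j: "j \<in> {1..r}" and "\<sigma> permutes {1..r}"
    by (simp_all add: atLeastLessThanSuc_atLeastAtMost del: upt_Suc)
  then have "\<sigma> j \<in> {1..r}" "j \<in> {1..r}"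
    by (simp_all only: permutes_in_image)
  then show "A (\<sigma> j) j = B (\<sigma> j) j"
    by (rule assms)
qed

text \<open>In the second factor the permutation acts on column indices, so that factor is the
  determinant of the transposed odd block.\<close>

lemma qBer_eq_qdet:
  "qBer s q r t A B = qdet s q r A * qdet s q t (\<lambda>i j. B (r + j) (r + i))"
  by (simp only: qBer_def qdet_def)

lemma even_prod_list:
  assumes "superalgebra sA pA" and "h 1 = 1"
    and "\<And>x y. x \<in> pA 0 \<Longrightarrow> y \<in> pA 0 \<Longrightarrow> h (x * y) = h x * h y"
    and "set xs \<subseteq> pA 0"
  shows "prod_list xs \<in> pA 0 \<and> h (prod_list xs) = prod_list (map h xs)"
  using assms(4)
proof (induction xs)
  case Nil
  show ?case
    using superalgebra.part_one[OF assms(1)] assms(2) by simp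
next
  case (Cons x xs)
  then have "x \<in> pA 0" "prod_list xs \<in> pA 0" "h (prod_list xs) = prod_list (map h xs)"
    by simp_all
  then show ?case
    using superalgebra.part_mult[OF assms(1), of x 0 "prod_list xs" 0] assms(3) by simp
qed

text \<open>Multiplicativity is asked for on even elements only, so that composites of super
  anti-homomorphisms qualify without tracking signs.\<close>

lemma even_qdet:
  assumes A: "superalgebra sA pA" and lin: "Vector_Spaces.linear sA sB h" and one: "h 1 = 1"
    and mult: "\<And>x y. x \<in> pA 0 \<Longrightarrow> y \<in> pA 0 \<Longrightarrow> h (x * y) = h x * h y"
    and X: "\<And>i j. i \<in> {1..r} \<Longrightarrow> j \<in> {1..r} \<Longrightarrow> X i j \<in> pA 0"
  shows "qdet sA q r X \<in> pA 0" "h (qdet sA q r X) = qdet sB q r (\<lambda>i j. h (X i j))"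
proof -
  interpret A: superalgebra sA pA
    by (fact A)
  interpret h: Vector_Spaces.linear sA sB h
    by (fact lin)
  have entries: "set (map (\<lambda>j. X (\<sigma> j) j) [1..<Suc r]) \<subseteq> pA 0" if "\<sigma> permutes {1..r}" for \<sigma>
  proof -
    have "X (\<sigma> j) j \<in> pA 0" if "j \<in> {1..r}" for j
      using that permutes_in_image[OF \<open>\<sigma> permutes {1..r}\<close>, of j] by (intro X) simp_all
    then show ?thesis
      by (auto simp del: upt_Suc)
  qed
  note * = even_prod_list[OF A one mult entries]
  show "qdet sA q r X \<in> pA 0"
    unfolding qdet_def
    by (intro A.subspace_sum[OF A.part_subspace] A.subspace_scale[OF A.part_subspace] *[THEN conjunct1])
      simp_all
  show "h (qdet sA q r X) = qdet sB q r (\<lambda>i j. h (X i j))"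
    unfolding qdet_def h.sum h.scale
    by (intro sum.cong refl arg_cong[where f = "sB _"])
      (simp only: mem_Collect_eq *[THEN conjunct2] map_map comp_def)
qed

text \<open>Both diagonal blocks of a parity matrix have even entries, because
  \<open>1 + 1 = 0\<close> in \<open>bit\<close>.\<close>

lemma even_qBer:
  assumes A: "superalgebra sA pA" and lin: "Vector_Spaces.linear sA sB h" and one: "h 1 = 1"
    and mult: "\<And>x y. x \<in> pA 0 \<Longrightarrow> y \<in> pA 0 \<Longrightarrow> h (x * y) = h x * h y"
    and "parity_matrix pA r t X" "parity_matrix pA r t Y"
  shows "h (qBer sA q r t X Y) =
    qdet sB q r (\<lambda>i j. h (X i j)) * qdet sB q t (\<lambda>i j. h (Y (r + j) (r + i)))"
proof -
  have "X i j \<in> pA 0" if "i \<in> {1..r}" "j \<in> {1..r}" for i j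
  proof -
    have "X i j \<in> pA (par r i + par r j)"
      using assms(5) that unfolding parity_matrix_def by auto
    then show ?thesis
      using that by (simp add: par_def)
  qed
  moreover have "Y (r + j) (r + i) \<in> pA 0" if "i \<in> {1..t}" "j \<in> {1..t}" for i j
  proof -
    have "Y (r + j) (r + i) \<in> pA (par r (r + j) + par r (r + i))"
      using assms(6) that unfolding parity_matrix_def by auto
    then show ?thesis
      using that by (simp add: par_def)
  qed
  ultimately show ?thesis
    unfolding qBer_eq_qdet using even_qdet[OF A lin one mult] mult by simp
qed

section \<open>Anti-homomorphisms, supertransposes and inverse matrices\<close>

lemma sg_add: "sg (a + b) = sg a * (sg b :: 'k::field)"
  by (cases a; cases b) (simp_all add: sg_def)

text \<open>The first two summands are the supertranspose signs of the entries \<open>(i, l)\<close>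
  and \<open>(l, j)\<close>, the third is the sign of reversing their product. Their total is free
  of the summation index \<open>l\<close>.\<close>

lemma supertranspose_sign:
  "i * (i + l) + l * (l + j) + (l + i) * (j + l) = i * (i + j)" for i j l :: bit
  by (cases i; cases j; cases l) simp_all

text \<open>Supertransposition and the anti-homomorphism both reverse the order of a matrix product,
  up to signs. These combine to one common sign, equal to 1 for \<open>i = j\<close>, and the
  off-diagonal sums vanish whatever it is.\<close>

lemma superalg_anti_hom_supertranspose:
  fixes sA :: "'k::field \<Rightarrow> 'a::ring_1 \<Rightarrow> 'a"
  assumes A: "superalgebra sA pA" and B: "superalgebra sB pB"
    and f: "superalg_anti_hom sA pA sB pB f"
    and parity: "parity_matrix pA m n X" "parity_matrix pA m n Y"
    and ij: "i \<in> {1..m+n}" "j \<in> {1..m+n}"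
    and inverse: "(\<Sum>l=1..m+n. supertranspose sA m X i l * supertranspose sA m Y l j) =
      (if i = j then 1 else 0)"
  shows "(\<Sum>l=1..m+n. f (Y j l) * f (X l i)) = (if j = i then 1 else 0)"
proof -
  interpret A: superalgebra sA pA
    by (fact A)
  interpret B: superalgebra sB pB
    by (fact B)
  interpret f: Vector_Spaces.linear sA sB f
    using f unfolding superalg_anti_hom_def by simp
  have one: "f 1 = 1"
    using f unfolding superalg_anti_hom_def by blast
  let ?P = "par m"
  have "f (supertranspose sA m X i l * supertranspose sA m Y l j) =
      sB (sg (?P i * (?P i + ?P j))) (f (Y j l) * f (X l i))" if l: "l \<in> {1..m+n}" for l
  proof -
    have *: "X l i \<in> pA (?P l + ?P i)" "Y j l \<in> pA (?P j + ?P l)"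
      using parity ij l unfolding parity_matrix_def by auto
    have sign: "sg (?P i * (?P i + ?P l)) * sg (?P l * (?P l + ?P j)) * sg ((?P l + ?P i) * (?P j + ?P l)) =
        (sg (?P i * (?P i + ?P j)) :: 'k)"
      by (simp only: sg_add[symmetric] supertranspose_sign)
    from * have "f (X l i * Y j l) = sB (sg ((?P l + ?P i) * (?P j + ?P l))) (f (Y j l) * f (X l i))"
      using f unfolding superalg_anti_hom_def by blast
    then show ?thesis
      unfolding supertranspose_def A.scale_mult_left A.scale_mult_right A.scale_scale f.scale
      by (simp only: sign[symmetric] B.scale_scale mult.assoc mult.left_commute)
  qed
  then have "f (\<Sum>l=1..m+n. supertranspose sA m X i l * supertranspose sA m Y l j) =
      sB (sg (?P i * (?P i + ?P j))) (\<Sum>l=1..m+n. f (Y j l) * f (X l i))"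
    unfolding f.sum B.scale_sum_right by (intro sum.cong refl)
  then have eq: "sB (sg (?P i * (?P i + ?P j))) (\<Sum>l=1..m+n. f (Y j l) * f (X l i)) =
      (if i = j then 1 else 0)"
    unfolding inverse if_distrib[of f] one f.zero by (rule sym)
  show ?thesis
  proof (cases "i = j")
    case True
    then have "?P i * (?P i + ?P j) = 0"
      by (cases "?P j") simp_all
    with eq True show ?thesis
      by (simp add: sg_def)
  next
    case False
    have "(sg (?P i * (?P i + ?P j)) :: 'k) \<noteq> 0"
      unfolding sg_def by simp
    with eq False show ?thesis
      by (simp only: B.scale_eq_0_iff if_False) simp
  qed
qed

lemma inverse_rels_sum:
  assumes "\<forall>(a, b) \<in> inverse_rels N A B. a = b" "i \<in> {1..N}" "j \<in> {1..N}"
  shows "(\<Sum>l=1..N. A i l * B l j) = (if i = j then 1 else 0)"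
    and "(\<Sum>l=1..N. B i l * A l j) = (if i = j then 1 else 0)"
proof -
  have "((\<Sum>l=1..N. A i l * B l j), if i = j then 1 else 0) \<in> inverse_rels N A B"
    "((\<Sum>l=1..N. B i l * A l j), if i = j then 1 else 0) \<in> inverse_rels N A B"
    unfolding inverse_rels_def
    by (rule UnI1 UnI2, rule CollectI, rule exI[of _ i], rule exI[of _ j], intro conjI refl assms)+
  from this[THEN eq_if_mem_rels[OF assms(1)]]
  show "(\<Sum>l=1..N. A i l * B l j) = (if i = j then 1 else 0)"
    and "(\<Sum>l=1..N. B i l * A l j) = (if i = j then 1 else 0)" .
qed

lemma tilde_pair_relations:
  assumes "tilde_pair s p q m n A B"
  shows "\<forall>(a, b) \<in> manin_rels s q m n A. a = b"
    and "\<forall>(a, b) \<in> inverse_rels (m + n) A B. a = b"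
    and "\<forall>(a, b) \<in> inverse_rels (m + n) (supertranspose s m A) (supertranspose s m B). a = b"
    and "parity_matrix p m n A" and "parity_matrix p m n B"
  using assms unfolding tilde_pair_def tilde_rels_def ball_Un by - (elim conjE, assumption)+

text \<open>A left inverse and a right inverse of \<open>Y\<close> agree by associativity.\<close>

lemma matrix_inverse_unique:
  fixes X Y Z :: "nat \<Rightarrow> nat \<Rightarrow> 'a::ring_1"
  assumes XY: "\<And>i j. i \<in> {1..N} \<Longrightarrow> j \<in> {1..N} \<Longrightarrow> (\<Sum>l=1..N. X i l * Y l j) = (if i = j then 1 else 0)"
    and YZ: "\<And>i j. i \<in> {1..N} \<Longrightarrow> j \<in> {1..N} \<Longrightarrow> (\<Sum>l=1..N. Y i l * Z l j) = (if i = j then 1 else 0)"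
    and ij: "i \<in> {1..N}" "j \<in> {1..N}"
  shows "X i j = Z i j"
proof -
  have "X i j = (\<Sum>l=1..N. X i l * (if l = j then 1 else 0))"
    using ij by (simp add: if_distrib cong: if_cong)
  also have "\<dots> = (\<Sum>l=1..N. X i l * (\<Sum>r=1..N. Y l r * Z r j))"
    by (intro sum.cong refl) (simp only: YZ ij)
  also have "\<dots> = (\<Sum>r=1..N. (\<Sum>l=1..N. X i l * Y l r) * Z r j)"
    unfolding sum_distrib_left sum_distrib_right mult.assoc by (rule sum.swap)
  also have "\<dots> = (\<Sum>r=1..N. (if i = r then 1 else 0) * Z r j)"
    by (intro sum.cong refl) (simp only: XY ij)
  also have "\<dots> = Z i j"
    using ij by (simp add: if_distrib[of "\<lambda>x. x * _"] cong: if_cong)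
  finally show ?thesis .
qed

text \<open>In block form \<open>A\<close> sends the last columns of \<open>C\<close> to
  \<open>(0, 1)\<close>. Multiplying these columns by \<open>P\<close> on the right makes their
  lower block 1, and the image becomes \<open>(0, P)\<close>; so \<open>P\<close> is the Schur
  complement.\<close>

lemma block_inverse_columns:
  fixes A C P :: "nat \<Rightarrow> nat \<Rightarrow> 'a::ring_1"
  assumes AC: "\<And>i j. i \<in> {1..k+N} \<Longrightarrow> j \<in> {1..k+N} \<Longrightarrow>
      (\<Sum>l=1..k+N. A i l * C l j) = (if i = j then 1 else 0)"
    and CP: "\<And>i j. i \<in> {1..N} \<Longrightarrow> j \<in> {1..N} \<Longrightarrow>
      (\<Sum>l=1..N. C (k + i) (k + l) * P l j) = (if i = j then 1 else 0)"
    and ij: "i \<in> {1..k+N}" "j \<in> {1..N}"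
  shows "A i (k + j) + (\<Sum>s=1..k. A i s * (\<Sum>l=1..N. C s (k + l) * P l j)) =
    (if i \<le> k then 0 else P (i - k) j)"
proof -
  have split: "(\<Sum>s=1..k+N. g s) = (\<Sum>s=1..k. g s) + (\<Sum>t=1..N. g (k + t))" for g :: "nat \<Rightarrow> 'a"
  proof -
    have "(\<Sum>s=k+1..k+N. g s) = (\<Sum>t=1..N. g (k + t))"
      using sum.shift_bounds_cl_nat_ivl[of g 1 k N] by (simp add: add.commute)
    then show ?thesis
      using sum.ub_add_nat[of 1 k g N] by simp
  qed
  \<comment> \<open>The isolated column is rewritten with 1 as lower right block of \<open>C\<close>
    times \<open>P\<close>, so that it supplies the missing terms of the sum over
    \<open>s\<close>.\<close>
  have "A i (k + j) = (\<Sum>t=1..N. A i (k + t) * (if t = j then 1 else 0))"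
    using ij by (simp add: if_distrib cong: if_cong)
  also have "\<dots> = (\<Sum>t=1..N. A i (k + t) * (\<Sum>l=1..N. C (k + t) (k + l) * P l j))"
    by (intro sum.cong refl) (simp only: CP ij)
  finally have "A i (k + j) + (\<Sum>s=1..k. A i s * (\<Sum>l=1..N. C s (k + l) * P l j)) =
      (\<Sum>s=1..k+N. A i s * (\<Sum>l=1..N. C s (k + l) * P l j))"
    unfolding split by (simp only: add.commute)
  also have "\<dots> = (\<Sum>l=1..N. (\<Sum>s=1..k+N. A i s * C s (k + l)) * P l j)"
    unfolding sum_distrib_left sum_distrib_right mult.assoc by (rule sum.swap)
  also have "\<dots> = (\<Sum>l=1..N. (if i = k + l then 1 else 0) * P l j)"
    using ij by (intro sum.cong refl arg_cong2[where f = "(*)"] AC) simp_all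
  \<comment> \<open>The surviving index \<open>l = i - k\<close> is in range only for
    \<open>k < i\<close>; the guard displays the two cases of the result.\<close>
  also have "\<dots> = (\<Sum>l=1..N. if l = i - k \<and> k < i then P l j else 0)"
    by (intro sum.cong refl) auto
  also have "\<dots> = (if i \<le> k then 0 else P (i - k) j)"
    using ij by (cases "k < i") auto
  finally show ?thesis .
qed

section \<open>The composite map and the Berezinian identity\<close>

text \<open>The two reversals cancel, and on even elements the signs are trivial.\<close>

lemma superalgebra_composite_even:
  assumes T: "superalgebra sT pT"
    and f: "superalg_anti_hom sT pT sT pT f" and g: "superalg_hom sT pT sE pE g"
    and h: "superalg_anti_hom sE pE sE pE h" and E: "superalgebra sE pE"
  shows "Vector_Spaces.linear sT sE (h \<circ> g \<circ> f)" "(h \<circ> g \<circ> f) 1 = 1"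
    and "\<And>x y. x \<in> pT 0 \<Longrightarrow> y \<in> pT 0 \<Longrightarrow>
      (h \<circ> g \<circ> f) (x * y) = (h \<circ> g \<circ> f) x * (h \<circ> g \<circ> f) y"
proof -
  interpret T: superalgebra sT pT
    by (fact T)
  interpret E: superalgebra sE pE
    by (fact E)
  have f': "Vector_Spaces.linear sT sT f" "f 1 = 1" "\<And>x. x \<in> pT 0 \<Longrightarrow> f x \<in> pT 0"
    "\<And>x y. x \<in> pT 0 \<Longrightarrow> y \<in> pT 0 \<Longrightarrow> f (x * y) = sT (sg (0 * 0)) (f y * f x)"
    using f unfolding superalg_anti_hom_def by blast+
  have g': "Vector_Spaces.linear sT sE g" "g 1 = 1" "\<And>x. x \<in> pT 0 \<Longrightarrow> g x \<in> pE 0"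
    "\<And>x y. g (x * y) = g x * g y"
    using g unfolding superalg_hom_def by blast+
  have h': "Vector_Spaces.linear sE sE h" "h 1 = 1"
    "\<And>x y. x \<in> pE 0 \<Longrightarrow> y \<in> pE 0 \<Longrightarrow> h (x * y) = sE (sg (0 * 0)) (h y * h x)"
    using h unfolding superalg_anti_hom_def by blast+
  show "Vector_Spaces.linear sT sE (h \<circ> g \<circ> f)"
    by (rule Vector_Spaces.linear_compose[OF f'(1) Vector_Spaces.linear_compose[OF g'(1) h'(1)]])
  show "(h \<circ> g \<circ> f) 1 = 1"
    by (simp add: f'(2) g'(2) h'(2))
  show "(h \<circ> g \<circ> f) (x * y) = (h \<circ> g \<circ> f) x * (h \<circ> g \<circ> f) y"
    if "x \<in> pT 0" "y \<in> pT 0" for x y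
    using that by (simp add: f'(3,4) g'(3,4) h'(3) sg_def)
qed

theorem theorem4p11:
  fixes q :: "'k::field" and k m n :: nat
    and sT :: "'k \<Rightarrow> 't::ring_1 \<Rightarrow> 't" and pT :: "bit \<Rightarrow> 't set"
    and M Minv :: "nat \<Rightarrow> nat \<Rightarrow> 't" and \<omega> :: "'t \<Rightarrow> 't"
    and sU :: "'k \<Rightarrow> 'u::ring_1 \<Rightarrow> 'u" and pU :: "bit \<Rightarrow> 'u set"
    and MK MKinv :: "nat \<Rightarrow> nat \<Rightarrow> 'u" and \<omega>K :: "'u \<Rightarrow> 'u"
    and sE :: "'k \<Rightarrow> 'e::ring_1 \<Rightarrow> 'e" and pE :: "bit \<Rightarrow> 'e set"
    and \<iota> :: "'u \<Rightarrow> 'e" and \<omega>E :: "'e \<Rightarrow> 'e" and \<phi> :: "'t \<Rightarrow> 'e"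
    and Ninv Kinv :: "nat \<Rightarrow> nat \<Rightarrow> 'e" and D :: 'e
  assumes q_nonzero: "q \<noteq> 0"
    \<comment> \<open>the superalgebras of type \<open>m|n\<close> and \<open>k+m|n\<close> with their anti-isomorphisms\<close>
    and T: "is_Mtilde q m n sT pT M Minv"
    and omega_T: "is_omega m n sT pT M Minv \<omega>"
    and U: "is_Mtilde q (k + m) n sU pU MK MKinv"
    and omega_U: "is_omega (k + m) n sU pU MK MKinv \<omega>K"
    \<comment> \<open>the extension \<open>E\<close> of the latter, to which its anti-isomorphism extends\<close>
    and E: "superalgebra sE pE"
    and iota: "superalg_hom sU pU sE pE \<iota>"
    and omega_E: "superalg_anti_hom sE pE sE pE \<omega>E"
    and omega_ext: "\<And>x. \<omega>E (\<iota> x) = \<iota> (\<omega>K x)"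
    \<comment> \<open>the lower right and the upper left principal submatrices and their inverses\<close>
    and lower_right: "tilde_pair sE pE q m n (\<lambda>i j. \<iota> (MK (k + i) (k + j))) Ninv"
    and upper_left: "tilde_pair sE pE q k 0 (\<lambda>i j. \<iota> (MK i j)) Kinv"
    \<comment> \<open>the homomorphism \<open>\<phi>\<^sub>k\<close>\<close>
    and phi: "superalg_hom sT pT sE pE \<phi>"
    and phi_M: "\<And>i j. i \<in> {1..m+n} \<Longrightarrow> j \<in> {1..m+n} \<Longrightarrow> \<phi> (M i j) = \<iota> (MK (k + i) (k + j))"
    and phi_Minv: "\<And>i j. i \<in> {1..m+n} \<Longrightarrow> j \<in> {1..m+n} \<Longrightarrow> \<phi> (Minv i j) = Ninv i j"
    \<comment> \<open>the inverse of the quantum determinant\<close>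
    and D_left: "D * qdet sE q k (\<lambda>i j. \<iota> (MK i j)) = 1"
    and D_right: "qdet sE q k (\<lambda>i j. \<iota> (MK i j)) * D = 1"
  shows "(\<omega>E \<circ> \<phi> \<circ> \<omega>) (qBer sT q m n M Minv)
       = D * \<iota> (qBer sU q (k + m) n MK MKinv)"
proof -
  interpret E: superalgebra sE pE
    by (fact E)
  have T': "superalgebra sT pT" and U': "superalgebra sU pU"
    using T U unfolding is_Mtilde_def by simp_all
  have f: "superalg_anti_hom sT pT sT pT \<omega>"
    and \<omega>_M: "\<And>i j. i \<in> {1..m+n} \<Longrightarrow> j \<in> {1..m+n} \<Longrightarrow> \<omega> (M i j) = Minv i j"
    using omega_T unfolding is_omega_def by blast+
  have \<omega>K_MK: "\<omega>K (MK i j) = MKinv i j" if "i \<in> {1..k+m+n}" "j \<in> {1..k+m+n}" for i j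
    using omega_U that unfolding is_omega_def by blast
  have \<iota>: "Vector_Spaces.linear sU sE \<iota>" "\<iota> 1 = 1" "\<And>x y. \<iota> (x * y) = \<iota> x * \<iota> y"
    using iota unfolding superalg_hom_def by blast+
  interpret \<iota>: Vector_Spaces.linear sU sE \<iota>
    by (fact \<iota>(1))
  note T_rel = tilde_pair_relations[OF is_Mtilde_tilde_pair[OF T]]
  note U_rel = tilde_pair_relations[OF is_Mtilde_tilde_pair[OF U]]
  note N_rel = tilde_pair_relations[OF lower_right]

  \<comment> \<open>\<open>\<omega>\<close> is prescribed on \<open>M\<close> only. Applied to the
    supertranspose relations it makes \<open>\<omega> (Minv i j)\<close> a right inverse of
    \<open>Minv\<close>, of which \<open>M\<close> is a left inverse.\<close>
  have "(\<Sum>l=1..m+n. Minv i l * \<omega> (Minv l j)) = (if i = j then 1 else 0)"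
    if ij: "i \<in> {1..m+n}" "j \<in> {1..m+n}" for i j
  proof -
    have "(\<Sum>l=1..m+n. Minv i l * \<omega> (Minv l j)) = (\<Sum>l=1..m+n. \<omega> (M i l) * \<omega> (Minv l j))"
      using ij by (intro sum.cong refl) (simp only: \<omega>_M)
    also have "\<dots> = (if i = j then 1 else 0)"
      by (intro superalg_anti_hom_supertranspose[OF T' T' f T_rel(5,4)]
          inverse_rels_sum(2)[OF T_rel(3)] ij)
    finally show ?thesis .
  qed
  then have \<omega>_Minv: "\<omega> (Minv i j) = M i j" if "i \<in> {1..m+n}" "j \<in> {1..m+n}" for i j
    using matrix_inverse_unique[OF inverse_rels_sum(1)[OF T_rel(2)], of "\<lambda>i j. \<omega> (Minv i j)" i j] that
    by simp

  let ?A = "\<lambda>i j. \<iota> (MK i j)" and ?C = "\<lambda>i j. \<iota> (MKinv i j)"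
  let ?N = "\<lambda>i j. \<iota> (MK (k + i) (k + j))"
  let ?P = "\<lambda>i j. \<omega>E (Ninv i j)"
  have \<omega>E_N: "\<omega>E (?N i j) = ?C (k + i) (k + j)" if "i \<in> {1..m+n}" "j \<in> {1..m+n}" for i j
    using that \<omega>K_MK[of "k + i" "k + j"] by (simp add: omega_ext)
  \<comment> \<open>The same argument in the extension: \<open>?P\<close> is a right inverse of the
    lower right block of the inverse matrix.\<close>
  have CP: "(\<Sum>l=1..m+n. ?C (k + i) (k + l) * ?P l j) = (if i = j then 1 else 0)"
    if ij: "i \<in> {1..m+n}" "j \<in> {1..m+n}" for i j
  proof -
    have "(\<Sum>l=1..m+n. ?C (k + i) (k + l) * ?P l j) = (\<Sum>l=1..m+n. \<omega>E (?N i l) * ?P l j)"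
      using ij by (intro sum.cong refl) (simp only: \<omega>E_N)
    also have "\<dots> = (if i = j then 1 else 0)"
      by (intro superalg_anti_hom_supertranspose[OF E E omega_E N_rel(5,4)]
          inverse_rels_sum(2)[OF N_rel(3)] ij)
    finally show ?thesis .
  qed
  have AC: "(\<Sum>l=1..k+(m+n). ?A i l * ?C l j) = (if i = j then 1 else 0)"
    if "i \<in> {1..k+(m+n)}" "j \<in> {1..k+(m+n)}" for i j
  proof -
    have "(\<Sum>l=1..k+(m+n). ?A i l * ?C l j) = \<iota> (\<Sum>l=1..k+m+n. MK i l * MKinv l j)"
      by (simp only: \<iota>.sum \<iota>(3) add.assoc)
    also have "\<dots> = \<iota> (if i = j then 1 else 0)"
      using that inverse_rels_sum(1)[OF U_rel(2), of i j] by (simp only: add.assoc)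
    finally show ?thesis
      by (simp only: if_distrib[of \<iota>] \<iota>(2) \<iota>.zero)
  qed
  have manin: "\<forall>(a, b) \<in> manin_rels sE q (k + m) n ?A. a = b"
  proof -
    have "\<iota> a = \<iota> b" if "(a, b) \<in> manin_rels sU q (k + m) n MK" for a b
      using eq_if_mem_rels[OF U_rel(1) that] by (rule arg_cong)
    then show ?thesis
      unfolding manin_rels_map[of \<iota> sU sE, OF \<iota>(3) \<iota>.diff \<iota>.scale \<iota>.zero]
      by (intro ballI) (clarsimp simp only: map_prod_simp prod.case)
  qed
  \<comment> \<open>The block identity is used in even rows and columns, while the multipliers still
    sum over all \<open>m + n\<close> indices.\<close>
  have "qdet sE q (k + m) ?A = qdet sE q k ?A * qdet sE q m ?P"
  proof (rule E.qdet_block[OF q_nonzero manin])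
    fix i j assume "i \<in> {1..k + m}" "j \<in> {1..m}"
    then show "?A i (k + j) + (\<Sum>s=1..k. ?A i s * (\<Sum>l=1..m+n. ?C s (k + l) * ?P l j)) =
        (if i \<le> k then 0 else ?P (i - k) j)"
      by (intro block_inverse_columns AC CP) simp_all
  qed
  then have sylvester: "qdet sE q m ?P = D * qdet sE q (k + m) ?A"
    using D_left by (simp flip: mult.assoc)

  let ?\<Theta> = "\<omega>E \<circ> \<phi> \<circ> \<omega>"
  have "?\<Theta> (qBer sT q m n M Minv) =
      qdet sE q m (\<lambda>i j. ?\<Theta> (M i j)) * qdet sE q n (\<lambda>i j. ?\<Theta> (Minv (m + j) (m + i)))"
    by (rule even_qBer[OF T' superalgebra_composite_even[OF T' f phi omega_E E] T_rel(4,5)])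
  \<comment> \<open>An entry of \<open>M\<close> passes through \<open>Minv\<close> and
    \<open>Ninv\<close> to \<open>?P\<close>.\<close>
  also have "qdet sE q m (\<lambda>i j. ?\<Theta> (M i j)) = qdet sE q m ?P"
    by (rule qdet_cong) (simp add: \<omega>_M phi_Minv)
  \<comment> \<open>An entry of \<open>Minv\<close> passes through \<open>M\<close> and the lower
    right block to the inverse matrix; index \<open>m + i\<close> becomes
    \<open>k + m + i\<close>.\<close>
  also have "qdet sE q n (\<lambda>i j. ?\<Theta> (Minv (m + j) (m + i))) =
      qdet sE q n (\<lambda>i j. ?C (k + m + j) (k + m + i))"
  proof (rule qdet_cong)
    fix i j assume "i \<in> {1..n}" "j \<in> {1..n}"
    then have ij: "m + i \<in> {1..m+n}" "m + j \<in> {1..m+n}"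
      by simp_all
    then have "?\<Theta> (Minv (m + j) (m + i)) = \<omega>E (?N (m + j) (m + i))"
      by (simp only: comp_apply \<omega>_Minv phi_M)
    also have "\<dots> = ?C (k + m + j) (k + m + i)"
      using \<omega>E_N[OF ij(2,1)] by (simp only: add.assoc)
    finally show "?\<Theta> (Minv (m + j) (m + i)) = ?C (k + m + j) (k + m + i)" .
  qed
  also have "qdet sE q m ?P * \<dots> = D * \<iota> (qBer sU q (k + m) n MK MKinv)"
    unfolding sylvester even_qBer[OF U' \<iota> U_rel(4,5)] by (simp only: mult.assoc)
  finally show ?thesis .
qed

end
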